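(* Let $\Lambda$ be a subgroup of $((0,+\infty),\cdot)$ and let $\Gamma\subset\mathbb{R}$ be a $\mathbb{Z}\cdot\Lambda$-submodule that is countable and dense in $\mathbb{R}$, and let $\ell\in\Gamma$ with $\ell>0$. Then the action $\beta:\Gamma\ltimes\Lambda\curvearrowright\mathbb{R}_\Gamma$ is topologically free, amenable and minimal. In other words, the groupoid $\Gamma\ltimes\Lambda\ltimes_\beta[0_+,\ell_-]$ is topologically principal, amenable and minimal.
   Context: $\mathbb{Z}\cdot\Lambda$ is the subring of $\mathbb{R}$ generated by $\Lambda$; a $\mathbb{Z}\cdot\Lambda$-submodule of $\mathbb{R}$ is an additive subgroup $\Gamma$ with $\Lambda\cdot\Gamma=\Gamma$. $\Gamma\ltimes\Lambda$ is the (discrete) group on the set $\Gamma\times\Lambda$ with product $(a,\mu)(b,\lambda)=(\lambda^{-1}a+b,\mu\lambda)$. $\mathbb{R}_\Gamma=(\mathbb{R}\setminus\Gamma)\sqcup\{a_+,a_-: a\in\Gamma\}$, with $q:\mathbb{R}_\Gamma\to\mathbb{R}$, $q(t)=t$, $q(a_\pm)=a$, is totally ordered by: $q(x)<q(y)\Rightarrow x<y$, and $a_-<a_+$ for $a\in\Gamma$; it carries the order topology. $[0_+,\ell_-]=\{x\in\mathbb{R}_\Gamma:0_+\le x\le\ell_-\}$. The action $\beta$ is $(c,\mu)(t)=\mu(t+c)$ for $t\in\mathbb{R}\setminus\Gamma$ and $(c,\mu)(a_\pm)=(\mu(a+c))_\pm$ for $a\in\Gamma$. $\Gamma\ltimes\Lambda\ltimes_\beta[0_+,\ell_-]$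 is the groupoid of pairs $(g,x)$ with $g\in\Gamma\ltimes\Lambda$ and $x,gx\in[0_+,\ell_-]$, source $x$, range $gx$, product $(g,hx)(h,x)=(gh,x)$, with the topology inherited from (discrete group) $\times\,\mathbb{R}_\Gamma$. An action is topologically free if for each $g\neq1$ the set of fixed points of $g$ has empty interior; minimal if every orbit is dense. A groupoid is topologically principal if the units with trivial isotropy group are dense in the unit space, and minimal if every orbit is dense in the unit space. Amenability is in the usual sense for actions and étale groupoids. *)

theory Defs
  imports "HOL-Analysis.Analysis" "HOL-Algebra.Group_Action"
begin

section \<open>Coefficient groups and the semidirect product\<close>

definition real_add_group :: "real monoid" where
  "real_add_group = \<lparr>carrier = UNIV, mult = (+), one = 0\<rparr>"

definition pos_real_mult_group :: "real monoid" where
  "pos_real_mult_group = \<lparr>carrier = {0<..}, mult = (*), one = 1\<rparr>"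

definition real_submodule :: "real set \<Rightarrow> real set \<Rightarrow> bool" where
  "real_submodule \<Lambda> \<Gamma> \<longleftrightarrow>
     subgroup \<Gamma> real_add_group \<and> (\<lambda>(\<mu>, c). \<mu> * c) ` (\<Lambda> \<times> \<Gamma>) = \<Gamma>"

definition semidirect :: "real set \<Rightarrow> real set \<Rightarrow> (real \<times> real) monoid" where
  "semidirect \<Gamma> \<Lambda> =
     \<lparr>carrier = \<Gamma> \<times> \<Lambda>,
      mult = (\<lambda>(a, \<mu>) (b, \<kappa>). (inverse \<kappa> * a + b, \<mu> * \<kappa>)),
      one = (0, 1)\<rparr>"


section \<open>The line with doubled points\<close>

text \<open>\<^term>\<open>Reg t\<close> stands for a point \<open>t\<close> outside \<open>\<Gamma>\<close>; \<^term>\<open>Minus a\<close> and \<^term>\<open>Plus a\<close>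
  stand for the two copies \<open>a\<^sub>-\<close>, \<open>a\<^sub>+\<close> of a point \<open>a\<close> of \<open>\<Gamma>\<close>.  The type contains all three
  versions of every real; \<open>split_line \<Gamma>\<close> below selects the ones that belong to the space.\<close>

datatype split_point = Minus real | Reg real | Plus real

fun split_proj :: "split_point \<Rightarrow> real" where
  "split_proj (Minus a) = a"
| "split_proj (Reg t) = t"
| "split_proj (Plus a) = a"

text \<open>The order is the required one on each \<open>split_line \<Gamma>\<close>; putting \<^term>\<open>Reg a\<close> between
  \<^term>\<open>Minus a\<close> and \<^term>\<open>Plus a\<close> only serves to make it linear on the whole type, since
  \<^term>\<open>Reg a\<close> never lies in the same \<open>split_line \<Gamma>\<close> as the other two.\<close>

fun split_side :: "split_point \<Rightarrow> int" where
  "split_side (Minus a) = -1"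
| "split_side (Reg t) = 0"
| "split_side (Plus a) = 1"

lemma split_point_eqI:
  "split_proj x = split_proj y \<Longrightarrow> split_side x = split_side y \<Longrightarrow> x = y"
  by (cases x; cases y) auto

instantiation split_point :: linorder
begin

definition less_split_point :: "split_point \<Rightarrow> split_point \<Rightarrow> bool" where
  "x < y \<longleftrightarrow>
     split_proj x < split_proj y \<or> (split_proj x = split_proj y \<and> split_side x < split_side y)"

definition less_eq_split_point :: "split_point \<Rightarrow> split_point \<Rightarrow> bool" where
  "x \<le> y \<longleftrightarrow> x < y \<or> x = (y :: split_point)"

instance
  by standard (auto simp: less_split_point_def less_eq_split_point_def intro: split_point_eqI)

end

definition split_line :: "real set \<Rightarrow> split_point set" where
  "split_line \<Gamma> = Reg ` (- \<Gamma>) \<union> Minus ` \<Gamma> \<union> Plus ` \<Gamma>"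

text \<open>The order topology of a subset \<open>A\<close> of a linear order, \<open>A\<close> being regarded as an ordered set
  in its own right: the open rays have their end points in \<open>A\<close>.\<close>

definition order_topology_on :: "'a::linorder set \<Rightarrow> 'a topology" where
  "order_topology_on A =
     topology_generated_by
       (insert A ((\<lambda>a. {x \<in> A. x < a}) ` A \<union> (\<lambda>a. {x \<in> A. a < x}) ` A))"

definition split_topology :: "real set \<Rightarrow> split_point topology" where
  "split_topology \<Gamma> = order_topology_on (split_line \<Gamma>)"

definition split_interval :: "real set \<Rightarrow> split_point \<Rightarrow> split_point \<Rightarrow> split_point set" where
  "split_interval \<Gamma> u v = {x \<in> split_line \<Gamma>. u \<le> x \<and> x \<le> v}"

fun split_action :: "real \<times> real \<Rightarrow> split_point \<Rightarrow> split_point" where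
  "split_action (c, \<mu>) (Minus a) = Minus (\<mu> * (a + c))"
| "split_action (c, \<mu>) (Reg t) = Reg (\<mu> * (t + c))"
| "split_action (c, \<mu>) (Plus a) = Plus (\<mu> * (a + c))"


section \<open>Actions of discrete groups on spaces\<close>

definition topologically_free_action ::
  "('g, 'c) monoid_scheme \<Rightarrow> 'x topology \<Rightarrow> ('g \<Rightarrow> 'x \<Rightarrow> 'x) \<Rightarrow> bool" where
  "topologically_free_action G X \<phi> \<longleftrightarrow>
     (\<forall>g \<in> carrier G - {\<one>\<^bsub>G\<^esub>}. X interior_of {x \<in> topspace X. \<phi> g x = x} = {})"

definition minimal_action ::
  "('g, 'c) monoid_scheme \<Rightarrow> 'x topology \<Rightarrow> ('g \<Rightarrow> 'x \<Rightarrow> 'x) \<Rightarrow> bool" where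
  "minimal_action G X \<phi> \<longleftrightarrow>
     (\<forall>x \<in> topspace X. X closure_of (orbit G \<phi> x) = topspace X)"

definition prob_functions :: "('g, 'c) monoid_scheme \<Rightarrow> ('g \<Rightarrow> real) set" where
  "prob_functions G = {p. (\<forall>g \<in> carrier G. 0 \<le> p g) \<and> (p has_sum 1) (carrier G)}"

text \<open>Amenability of an action on a locally compact space: there is a net of continuous maps
  \<open>m\<close> from \<open>X\<close> to the probability measures on \<open>G\<close> such that the \<open>\<ell>\<^sup>1\<close>-norm of
  \<open>g m\<^sub>x - m\<^sub>g\<^sub>x\<close> tends to 0 uniformly on compact subsets of \<open>G \<times> X\<close>.  Nets of maps are given by
  proper filters on the set of maps.  Continuity is for the topology of pointwise convergence,
  which on probability functions coincides with the weak-* topology.\<close>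

definition amenable_action ::
  "('g, 'c) monoid_scheme \<Rightarrow> 'x topology \<Rightarrow> ('g \<Rightarrow> 'x \<Rightarrow> 'x) \<Rightarrow> bool" where
  "amenable_action G X \<phi> \<longleftrightarrow>
     (\<exists>F :: ('x \<Rightarrow> 'g \<Rightarrow> real) filter.
        F \<noteq> bot \<and>
        (\<forall>\<^sub>F m in F.
           (\<forall>x \<in> topspace X. m x \<in> prob_functions G) \<and>
           (\<forall>h \<in> carrier G. continuous_map X euclideanreal (\<lambda>x. m x h))) \<and>
        (\<forall>K. compactin (prod_topology (discrete_topology (carrier G)) X) K \<longrightarrow>
           uniform_limit K
             (\<lambda>m (g, x). \<Sum>\<^sub>\<infinity>h \<in> carrier G. \<bar>m x (inv\<^bsub>G\<^esub> g \<otimes>\<^bsub>G\<^esub> h) - m (\<phi> g x) h\<bar>)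
             (\<lambda>_. 0) F))"


section \<open>Topological groupoids\<close>

text \<open>The set of arrows and the set of units are the topspaces of the first two components.
  \<open>gcomp G a b\<close> is only meaningful if \<open>gsource G a = grange G b\<close>.\<close>

record ('u, 'a) top_groupoid =
  arrows :: "'a topology"
  units :: "'u topology"
  gsource :: "'a \<Rightarrow> 'u"
  grange :: "'a \<Rightarrow> 'u"
  gident :: "'u \<Rightarrow> 'a"
  gcomp :: "'a \<Rightarrow> 'a \<Rightarrow> 'a"
  ginv :: "'a \<Rightarrow> 'a"

definition isotropy :: "('u, 'a) top_groupoid \<Rightarrow> 'u \<Rightarrow> 'a set" where
  "isotropy G u = {a \<in> topspace (arrows G). gsource G a = u \<and> grange G a = u}"

definition range_fibre :: "('u, 'a) top_groupoid \<Rightarrow> 'u \<Rightarrow> 'a set" where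
  "range_fibre G u = {a \<in> topspace (arrows G). grange G a = u}"

definition groupoid_orbit :: "('u, 'a) top_groupoid \<Rightarrow> 'u \<Rightarrow> 'u set" where
  "groupoid_orbit G u = grange G ` {a \<in> topspace (arrows G). gsource G a = u}"

definition topologically_principal :: "('u, 'a) top_groupoid \<Rightarrow> bool" where
  "topologically_principal G \<longleftrightarrow>
     units G closure_of {u \<in> topspace (units G). isotropy G u = {gident G u}} = topspace (units G)"

definition minimal_groupoid :: "('u, 'a) top_groupoid \<Rightarrow> bool" where
  "minimal_groupoid G \<longleftrightarrow>
     (\<forall>u \<in> topspace (units G). units G closure_of (groupoid_orbit G u) = topspace (units G))"

text \<open>For a Hausdorff space, these are the nonnegative elements of \<open>C\<^sub>c\<close>.\<close>

definition nonneg_Cc :: "'a topology \<Rightarrow> ('a \<Rightarrow> real) set" where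
  "nonneg_Cc X =
     {f. continuous_map X euclideanreal f \<and> (\<forall>a \<in> topspace X. 0 \<le> f a) \<and>
         (\<exists>K. compactin X K \<and> (\<forall>a \<in> topspace X - K. f a = 0))}"

text \<open>Amenability of a (locally compact Hausdorff) etale groupoid: there is a net of nonnegative
  compactly supported continuous functions \<open>f\<close> whose sums over the range fibres tend to 1
  uniformly on compact sets of units and which are asymptotically left invariant, uniformly on
  compact sets of arrows.  The range fibres of an etale groupoid are closed and discrete, so that
  all the sums have only finitely many nonzero terms.\<close>

definition amenable_groupoid :: "('u, 'a) top_groupoid \<Rightarrow> bool" where
  "amenable_groupoid G \<longleftrightarrow>
     (\<exists>F :: ('a \<Rightarrow> real) filter.
        F \<noteq> bot \<and>
        (\<forall>\<^sub>F f in F. f \<in> nonneg_Cc (arrows G)) \<and>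
        (\<forall>K. compactin (units G) K \<longrightarrow>
           uniform_limit K (\<lambda>f u. \<Sum>\<^sub>\<infinity>b \<in> range_fibre G u. f b) (\<lambda>_. 1) F) \<and>
        (\<forall>K. compactin (arrows G) K \<longrightarrow>
           uniform_limit K
             (\<lambda>f a. \<Sum>\<^sub>\<infinity>b \<in> range_fibre G (grange G a). \<bar>f (gcomp G (ginv G a) b) - f b\<bar>)
             (\<lambda>_. 0) F))"

text \<open>The transformation groupoid of an action, restricted to a set \<open>Y\<close> of units.  The unit
  \<open>(1, x)\<close> is identified with the point \<open>x\<close>.\<close>

definition restricted_transformation_groupoid ::
  "('g, 'c) monoid_scheme \<Rightarrow> 'x topology \<Rightarrow> ('g \<Rightarrow> 'x \<Rightarrow> 'x) \<Rightarrow> 'x set \<Rightarrow>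
     ('x, 'g \<times> 'x) top_groupoid" where
  "restricted_transformation_groupoid G X \<phi> Y =
     \<lparr>arrows = subtopology (prod_topology (discrete_topology (carrier G)) X)
                {(g, x). g \<in> carrier G \<and> x \<in> Y \<and> \<phi> g x \<in> Y},
      units = subtopology X Y,
      gsource = (\<lambda>(g, x). x),
      grange = (\<lambda>(g, x). \<phi> g x),
      gident = (\<lambda>x. (\<one>\<^bsub>G\<^esub>, x)),
      gcomp = (\<lambda>(g, y) (h, x). (g \<otimes>\<^bsub>G\<^esub> h, x)),
      ginv = (\<lambda>(g, x). (inv\<^bsub>G\<^esub> g, \<phi> g x))\<rparr>"

definition split_groupoid ::
  "real set \<Rightarrow> real set \<Rightarrow> real \<Rightarrow> (split_point, (real \<times> real) \<times> split_point) top_groupoid" where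
  "split_groupoid \<Gamma> \<Lambda> l =
     restricted_transformation_groupoid (semidirect \<Gamma> \<Lambda>) (split_topology \<Gamma>) split_action
       (split_interval \<Gamma> (Plus 0) (Minus l))"

end

theory Submission
  imports Defs
begin

text \<open>The semidirect product is metabelian, so it carries explicit Reiter functions: normalised
  counts of the values of a map into the group defined on a box of exponents.  Taken constant in
  \<open>x\<close>, they make every action of the group amenable.  For the groupoid, \<open>[0\<^sub>+, \<ell>\<^sub>-]\<close> is a
  compact open fundamental domain for the translations by \<open>\<int>\<ell>\<close>, so that every range fibre is in
  bijection with the left cosets of \<open>\<int>\<ell>\<close>, compatibly with left multiplication; counting values in
  a coset then gives functions with fibre sums exactly 1.  Freeness and minimality hold because
  every nonempty open set contains all points over a nonempty open interval of \<open>\<real>\<close>, whereas a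
  nontrivial group element fixes points over at most one real number.\<close>

section \<open>Order intervals of the split line\<close>

text \<open>Finitely supported Reiter functions on the group cannot simply be restricted to the
  groupoid over the interval: the range fibre of \<open>u\<close> contains only those group elements
  whose inverse carries \<open>u\<close> back into the interval, and these may miss the whole
  support, leaving fibre sum 0. Hence the mass of each \<open>g\<close> is moved to the one arrow
  into \<open>u\<close> whose group part lies in the left coset of \<open>g\<close>. Moving mass
  along a map never increases an l1 distance, so one estimate with one constant covers both the
  action and the groupoid.

  Indices are counted instead of elements of a finite subset of the group because the generators may
  satisfy relations: different exponents can yield the same group element, and multiplicities absorb
  this.\<close>

lemma split_line_simps [simp]:
  "Reg t \<in> split_line \<Gamma> \<longleftrightarrow> t \<notin> \<Gamma>"
  "Minus t \<in> split_line \<Gamma> \<longleftrightarrow> t \<in> \<Gamma>"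
  "Plus t \<in> split_line \<Gamma> \<longleftrightarrow> t \<in> \<Gamma>"
  by (auto simp: split_line_def)

lemma ex_split_line_proj: "\<exists>x \<in> split_line \<Gamma>. split_proj x = t"
  by (metis split_line_simps(1,2) split_proj.simps(1,2))

lemma topspace_split_topology [simp]: "topspace (split_topology \<Gamma>) = split_line \<Gamma>"
  by (auto simp: split_topology_def order_topology_on_def)

lemma openin_split_rays:
  assumes "a \<in> split_line \<Gamma>"
  shows "openin (split_topology \<Gamma>) {x \<in> split_line \<Gamma>. x < a}"
    and "openin (split_topology \<Gamma>) {x \<in> split_line \<Gamma>. a < x}"
  using assms unfolding split_topology_def order_topology_on_def
  by (auto intro!: topology_generated_by_Basis)

text \<open>The order is traded for inequalities between reals and four excluded points, a form that
  case analysis on the point settles. \<open>Reg a\<close> and \<open>Reg b\<close> are excluded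
  because the auxiliary order puts \<open>Reg\<close> strictly between the two copies.\<close>

lemma mem_split_interval_Plus_Minus:
  "x \<in> split_interval \<Gamma> (Plus a) (Minus b) \<longleftrightarrow>
     x \<in> split_line \<Gamma> \<and> a \<le> split_proj x \<and> split_proj x \<le> b \<and>
     x \<noteq> Minus a \<and> x \<noteq> Reg a \<and> x \<noteq> Reg b \<and> x \<noteq> Plus b"
  by (cases x) (auto simp: split_interval_def less_eq_split_point_def less_split_point_def)

text \<open>In the split line \<open>Minus a\<close> is the immediate predecessor of
  \<open>Plus a\<close>, and \<open>Plus b\<close> the immediate successor of
  \<open>Minus b\<close>. The closed interval is therefore also an open one.\<close>

lemma openin_split_interval:
  assumes "a \<in> \<Gamma>" "b \<in> \<Gamma>"
  shows "openin (split_topology \<Gamma>) (split_interval \<Gamma> (Plus a) (Minus b))"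
proof -
  have "split_interval \<Gamma> (Plus a) (Minus b) =
      {x \<in> split_line \<Gamma>. Minus a < x} \<inter> {x \<in> split_line \<Gamma>. x < Plus b}" (is "?L = ?R")
  proof (intro equalityI subsetI)
    fix x assume "x \<in> ?L"
    then show "x \<in> ?R" unfolding mem_split_interval_Plus_Minus
      by (cases x) (auto simp: less_split_point_def)
  next
    fix x assume "x \<in> ?R"
    then show "x \<in> ?L" unfolding mem_split_interval_Plus_Minus
      using assms by (cases x) (auto simp: less_split_point_def)
  qed
  then show ?thesis
    using assms by (simp add: openin_Int openin_split_rays)
qed

text \<open>Points of \<open>\<Gamma>\<close> are doubled precisely so that their neighbourhoods become one-sided.\<close>

definition right_nbhd :: "real set \<Rightarrow> split_point set \<Rightarrow> real \<Rightarrow> real \<Rightarrow> bool" where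
  "right_nbhd \<Gamma> U t e \<longleftrightarrow> (\<forall>x \<in> split_line \<Gamma>. t < split_proj x \<and> split_proj x < t + e \<longrightarrow> x \<in> U)"

definition left_nbhd :: "real set \<Rightarrow> split_point set \<Rightarrow> real \<Rightarrow> real \<Rightarrow> bool" where
  "left_nbhd \<Gamma> U t e \<longleftrightarrow> (\<forall>x \<in> split_line \<Gamma>. t - e < split_proj x \<and> split_proj x < t \<longrightarrow> x \<in> U)"

text \<open>The property holds for rays and passes to unions and, with the smaller radius, to
  intersections. A \<open>Plus\<close> point sees only its right side, a \<open>Minus\<close> point
  only its left side, a \<open>Reg\<close> point both.\<close>

lemma split_topology_nbhd:
  assumes "openin (split_topology \<Gamma>) U" "z \<in> U"
  obtains e where "e > 0"
    "split_side z \<ge> 0 \<Longrightarrow> right_nbhd \<Gamma> U (split_proj z) e"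
    "split_side z \<le> 0 \<Longrightarrow> left_nbhd \<Gamma> U (split_proj z) e"
proof -
  define N where "N \<equiv> \<lambda>U z. \<exists>e>0. (split_side z \<ge> 0 \<longrightarrow> right_nbhd \<Gamma> U (split_proj z) e) \<and>
    (split_side z \<le> 0 \<longrightarrow> left_nbhd \<Gamma> U (split_proj z) e)"
  have N_mono: "N V z" if "N U z" "U \<subseteq> V" for U V z
    using that unfolding N_def right_nbhd_def left_nbhd_def by (meson subsetD)
  have "generate_topology_on
      (insert (split_line \<Gamma>) ((\<lambda>a. {x \<in> split_line \<Gamma>. x < a}) ` split_line \<Gamma> \<union>
        (\<lambda>a. {x \<in> split_line \<Gamma>. a < x}) ` split_line \<Gamma>)) U"
    using assms(1) unfolding split_topology_def order_topology_on_def
    by (simp add: openin_topology_generated_by_iff)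
  then have "\<forall>z\<in>U. N U z"
  proof (induction rule: generate_topology_on.induct)
    case Empty
    then show ?case by simp
  next
    case (Int A B)
    show ?case
    proof
      fix z assume "z \<in> A \<inter> B"
      then obtain d e where
        "d > 0" "split_side z \<ge> 0 \<longrightarrow> right_nbhd \<Gamma> A (split_proj z) d"
          "split_side z \<le> 0 \<longrightarrow> left_nbhd \<Gamma> A (split_proj z) d"
        and "e > 0" "split_side z \<ge> 0 \<longrightarrow> right_nbhd \<Gamma> B (split_proj z) e"
          "split_side z \<le> 0 \<longrightarrow> left_nbhd \<Gamma> B (split_proj z) e"
        using Int.IH unfolding N_def by blast
      then show "N (A \<inter> B) z"
        unfolding N_def right_nbhd_def left_nbhd_def by (intro exI[of _ "min d e"]) auto
    qed
  next
    case (UN K)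
    then show ?case by (meson N_mono UnionE Union_upper)
  next
    case (Basis s)
    then consider "s = split_line \<Gamma>"
      | a where "a \<in> split_line \<Gamma>" "s = {x \<in> split_line \<Gamma>. x < a}"
      | a where "a \<in> split_line \<Gamma>" "s = {x \<in> split_line \<Gamma>. a < x}"
      by blast
    then show ?case
    proof cases
      case 1
      then show ?thesis
        by (auto simp: N_def right_nbhd_def left_nbhd_def intro: exI[of _ 1])
    next
      case 2
      show ?thesis
      proof
        fix z assume "z \<in> s"
        then have z: "z \<in> split_line \<Gamma>" "z < a" using 2 by auto
        show "N s z"
        proof (cases "split_proj z < split_proj a")
          case True
          then show ?thesis
            unfolding N_def right_nbhd_def left_nbhd_def 2
            by (intro exI[of _ "split_proj a - split_proj z"]) (auto simp: less_split_point_def)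
        next
          case False
          then have eq: "split_proj z = split_proj a" using z by (auto simp: less_split_point_def)
          \<comment> \<open>Two points of the split line over the same real are its two copies, so
            \<open>z\<close> is the \<open>Minus\<close> copy. Only its left side matters, and all
            of that lies in the ray; the radius is arbitrary.\<close>
          then have "split_side z < 0"
            using z 2 by (cases z; cases a) (auto simp: less_split_point_def)
          then show ?thesis
            unfolding N_def right_nbhd_def left_nbhd_def 2
            by (intro exI[of _ 1]) (auto simp: less_split_point_def eq)
        qed
      qed
    next
      case 3
      show ?thesis
      proof
        fix z assume "z \<in> s"
        then have z: "z \<in> split_line \<Gamma>" "a < z" using 3 by auto
        show "N s z"
        proof (cases "split_proj a < split_proj z")
          case True
          then show ?thesis
            unfolding N_def right_nbhd_def left_nbhd_def 3
            by (intro exI[of _ "split_proj z - split_proj a"]) (auto simp: less_split_point_def)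
        next
          case False
          then have eq: "split_proj z = split_proj a" using z by (auto simp: less_split_point_def)
          then have "split_side z > 0"
            using z 3 by (cases z; cases a) (auto simp: less_split_point_def)
          then show ?thesis
            unfolding N_def right_nbhd_def left_nbhd_def 3
            by (intro exI[of _ 1]) (auto simp: less_split_point_def eq)
        qed
      qed
    qed
  qed
  then show thesis
    using assms(2) that unfolding N_def by blast
qed

lemma openin_split_contains_interval:
  assumes "openin (split_topology \<Gamma>) U" "U \<noteq> {}"
  obtains s t where "s < t" "{x \<in> split_line \<Gamma>. s < split_proj x \<and> split_proj x < t} \<subseteq> U"
proof -
  obtain z where "z \<in> U" using assms by blast
  then obtain e where e: "e > 0"
    "split_side z \<ge> 0 \<Longrightarrow> right_nbhd \<Gamma> U (split_proj z) e"
    "split_side z \<le> 0 \<Longrightarrow> left_nbhd \<Gamma> U (split_proj z) e"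
    using split_topology_nbhd assms(1) by metis
  show thesis
  proof (cases "split_side z \<ge> 0")
    case True
    then show ?thesis
      using that[of "split_proj z" "split_proj z + e"] e by (auto simp: right_nbhd_def)
  next
    case False
    then show ?thesis
      using that[of "split_proj z - e" "split_proj z"] e by (force simp: left_nbhd_def)
  qed
qed

text \<open>Bisection on the real line: a finite subcover is sought for the points over
  \<open>[s, t]\<close>. Locally it exists because the fibre over \<open>p\<close> is finite and the
  cover members chosen for its points jointly contain everything over a neighbourhood of
  \<open>p\<close>.\<close>

lemma compactin_split_interval:
  assumes "a \<in> \<Gamma>" "b \<in> \<Gamma>"
  shows "compactin (split_topology \<Gamma>) (split_interval \<Gamma> (Plus a) (Minus b))"
proof (cases "a \<le> b")
  case False
  then have "split_interval \<Gamma> (Plus a) (Minus b) = {}"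
    by (auto simp: mem_split_interval_Plus_Minus)
  then show ?thesis by simp
next
  case True
  define Y where "Y = split_interval \<Gamma> (Plus a) (Minus b)"
  have Y: "x \<in> Y \<longleftrightarrow> x \<in> split_line \<Gamma> \<and> a \<le> split_proj x \<and> split_proj x \<le> b \<and>
     x \<noteq> Minus a \<and> x \<noteq> Reg a \<and> x \<noteq> Reg b \<and> x \<noteq> Plus b" for x
    unfolding Y_def by (rule mem_split_interval_Plus_Minus)
  have "\<exists>\<F>. finite \<F> \<and> \<F> \<subseteq> \<U> \<and> Y \<subseteq> \<Union>\<F>"
    if open_cover: "\<And>U. U \<in> \<U> \<Longrightarrow> openin (split_topology \<Gamma>) U" "Y \<subseteq> \<Union>\<U>" for \<U>
  proof -
    define P where
      "P s t \<longleftrightarrow> (\<exists>\<F>. finite \<F> \<and> \<F> \<subseteq> \<U> \<and> {x \<in> Y. s \<le> split_proj x \<and> split_proj x \<le> t} \<subseteq> \<Union>\<F>)"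
      for s t
    have "P a b"
    proof (rule Bolzano[OF True])
      fix r s t assume "P r s" "P s t"
      then obtain \<F> \<G> where "finite \<F>" "\<F> \<subseteq> \<U>" "{x \<in> Y. r \<le> split_proj x \<and> split_proj x \<le> s} \<subseteq> \<Union>\<F>"
        "finite \<G>" "\<G> \<subseteq> \<U>" "{x \<in> Y. s \<le> split_proj x \<and> split_proj x \<le> t} \<subseteq> \<Union>\<G>"
        unfolding P_def by blast
      moreover from this have "{x \<in> Y. r \<le> split_proj x \<and> split_proj x \<le> t} \<subseteq> \<Union>(\<F> \<union> \<G>)"
        by (smt (verit) Collect_mono_iff Sup_union_distrib UnCI mem_Collect_eq subset_iff)
      ultimately show "P r t"
        unfolding P_def by (intro exI[of _ "\<F> \<union> \<G>"]) auto
    next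
      fix p assume "a \<le> p" "p \<le> b"
      define Z where "Z = {z \<in> Y. split_proj z = p}"
      have "Z \<subseteq> {Minus p, Reg p, Plus p}"
      proof
        fix z assume "z \<in> Z"
        then show "z \<in> {Minus p, Reg p, Plus p}" by (cases z) (auto simp: Z_def)
      qed
      then have "finite Z" by (rule finite_subset) auto
      have "\<exists>U e. U \<in> \<U> \<and> z \<in> U \<and> e > 0 \<and>
          (split_side z \<ge> 0 \<longrightarrow> right_nbhd \<Gamma> U p e) \<and> (split_side z \<le> 0 \<longrightarrow> left_nbhd \<Gamma> U p e)"
        if "z \<in> Z" for z
      proof -
        have "z \<in> \<Union>\<U>" using that open_cover(2) unfolding Z_def by blast
        then obtain U where "U \<in> \<U>" "z \<in> U" by blast
        then show ?thesis
          using split_topology_nbhd[OF open_cover(1), of U z] \<open>z \<in> Z\<close> unfolding Z_def by blast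
      qed
      then obtain U e where Ue: "\<And>z. z \<in> Z \<Longrightarrow> U z \<in> \<U> \<and> z \<in> U z \<and> e z > (0::real) \<and>
          (split_side z \<ge> 0 \<longrightarrow> right_nbhd \<Gamma> (U z) p (e z)) \<and>
          (split_side z \<le> 0 \<longrightarrow> left_nbhd \<Gamma> (U z) p (e z))"
        by metis
      \<comment> \<open>The inserted 1 keeps the minimum meaningful for an empty fibre, which occurs
        when \<open>a = b\<close>.\<close>
      define d where "d = Min (insert 1 (e ` Z))"
      have "d > 0" and d_le: "\<And>z. z \<in> Z \<Longrightarrow> d \<le> e z"
        using \<open>finite Z\<close> Ue by (auto simp: d_def)
      have "P s t" if "s \<le> p" "p \<le> t" "t - s < d" for s t
        unfolding P_def
      proof (intro exI conjI subsetI)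
        fix x assume "x \<in> {x \<in> Y. s \<le> split_proj x \<and> split_proj x \<le> t}"
        then have x: "x \<in> Y" "s \<le> split_proj x" "split_proj x \<le> t" by auto
        then have xl: "x \<in> split_line \<Gamma>" by (simp add: Y)
        consider "split_proj x = p" | "split_proj x < p" | "split_proj x > p" by linarith
        then show "x \<in> \<Union>(U ` Z)"
        proof cases
          case 1
          then have "x \<in> Z" using x by (simp add: Z_def)
          then show ?thesis using Ue by blast
        next
          case 2
          \<comment> \<open>A point of \<open>Y\<close> to the left of \<open>p\<close> forces
            \<open>a < p\<close>, so the fibre over \<open>p\<close> has not lost the point that
            looks to the left.\<close>
          then have "\<exists>z\<in>Z. split_side z \<le> 0"
          proof (cases "p \<in> \<Gamma>")
            case True
            then have "Minus p \<in> Z" using 2 x \<open>p \<le> b\<close> by (auto simp: Z_def Y)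
            then show ?thesis by force
          next
            case False
            then have "Reg p \<in> Z" using assms 2 x \<open>p \<le> b\<close> by (auto simp: Z_def Y)
            then show ?thesis by force
          qed
          then obtain z where z: "z \<in> Z" "split_side z \<le> 0" by blast
          then have "x \<in> U z"
            using Ue[OF z(1)] d_le[OF z(1)] 2 x xl that by (auto simp: left_nbhd_def)
          then show ?thesis using z by blast
        next
          case 3
          then have "\<exists>z\<in>Z. split_side z \<ge> 0"
          proof (cases "p \<in> \<Gamma>")
            case True
            then have "Plus p \<in> Z" using 3 x \<open>a \<le> p\<close> by (auto simp: Z_def Y)
            then show ?thesis by force
          next
            case False
            then have "Reg p \<in> Z" using assms 3 x \<open>a \<le> p\<close> by (auto simp: Z_def Y)
            then show ?thesis by force
          qed
          then obtain z where z: "z \<in> Z" "split_side z \<ge> 0" by blast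
          then have "x \<in> U z"
            using Ue[OF z(1)] d_le[OF z(1)] 3 x xl that by (auto simp: right_nbhd_def)
          then show ?thesis using z by blast
        qed
      qed (use \<open>finite Z\<close> Ue in auto)
      then show "\<exists>d>0. \<forall>s t. s \<le> p \<and> p \<le> t \<and> t - s < d \<longrightarrow> P s t"
        using \<open>d > 0\<close> by blast
    qed
    then show ?thesis
      unfolding P_def using Y by (smt (verit) mem_Collect_eq subset_iff)
  qed
  then show ?thesis
    unfolding compactin_def Y_def by (auto simp: split_interval_def)
qed

section \<open>Almost invariant families in the semidirect product\<close>

lemma has_sum_card_fibres:
  fixes \<psi> :: "'i \<Rightarrow> 'b"
  assumes "finite I" "\<psi> ` I \<subseteq> B"
  shows "((\<lambda>b. real (card {i \<in> I. \<psi> i = b})) has_sum real (card I)) B"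
proof (rule has_sum_finite_neutralI)
  show "finite (\<psi> ` I)" "\<psi> ` I \<subseteq> B" using assms by auto
  show "real (card {i \<in> I. \<psi> i = b}) = 0" if "b \<in> B - \<psi> ` I" for b
  proof -
    have "{i \<in> I. \<psi> i = b} = {}" using that by auto
    then show ?thesis by (simp only: card.empty of_nat_0)
  qed
  have "card I = card (\<Union>b\<in>\<psi> ` I. {i \<in> I. \<psi> i = b})"
    by (rule arg_cong[where f = card]) auto
  also have "\<dots> = (\<Sum>b\<in>\<psi> ` I. card {i \<in> I. \<psi> i = b})"
    using assms by (intro card_UN_disjoint) auto
  finally show "real (card I) = (\<Sum>b\<in>\<psi> ` I. real (card {i \<in> I. \<psi> i = b}))"
    by simp
qed

lemma has_sum_card_fibres_normalised:
  fixes \<psi> :: "'i \<Rightarrow> 'b"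
  assumes "finite I" "I \<noteq> {}" "\<psi> ` I \<subseteq> B"
  shows "((\<lambda>b. real (card {i \<in> I. \<psi> i = b}) / real (card I)) has_sum 1) B"
proof -
  have "((\<lambda>b. real (card {i \<in> I. \<psi> i = b}) * inverse (real (card I))) has_sum
      (real (card I) * inverse (real (card I)))) B"
    by (intro has_sum_cmult_left has_sum_card_fibres assms)
  then show ?thesis using assms by (simp add: divide_inverse)
qed

text \<open>The partial injection \<open>\<sigma>\<close> matches the fibres of \<open>\<psi>\<close> with those of \<open>\<theta>\<close>; only the unmatched
  indices on either side contribute.\<close>

lemma infsum_card_fibres_diff_le:
  fixes \<psi> \<theta> :: "'i \<Rightarrow> 'b"
  assumes "finite I" "\<psi> ` I \<subseteq> B" "\<theta> ` I \<subseteq> B"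
    and J: "J \<subseteq> I" "inj_on \<sigma> J" "\<sigma> ` J \<subseteq> I" "\<And>i. i \<in> J \<Longrightarrow> \<theta> (\<sigma> i) = \<psi> i"
  shows "(\<Sum>\<^sub>\<infinity>b\<in>B. \<bar>real (card {i \<in> I. \<psi> i = b}) - real (card {i \<in> I. \<theta> i = b})\<bar>)
    \<le> 2 * real (card (I - J))"
proof -
  have fin: "finite J" "finite (I - J)" "finite (I - \<sigma> ` J)"
    using assms finite_subset by auto
  have split: "card {i \<in> I. \<phi> i = b} = card {i \<in> K. \<phi> i = b} + card {i \<in> I - K. \<phi> i = b}"
    if "K \<subseteq> I" for K b and \<phi> :: "'i \<Rightarrow> 'b"
  proof -
    have "{i \<in> I. \<phi> i = b} = {i \<in> K. \<phi> i = b} \<union> {i \<in> I - K. \<phi> i = b}" using that by auto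
    also have "card \<dots> = card {i \<in> K. \<phi> i = b} + card {i \<in> I - K. \<phi> i = b}"
      using assms(1) that by (intro card_Un_disjoint) (auto intro: finite_subset)
    finally show ?thesis .
  qed
  have matched: "card {i \<in> \<sigma> ` J. \<theta> i = b} = card {i \<in> J. \<psi> i = b}" for b
  proof -
    have "{i \<in> \<sigma> ` J. \<theta> i = b} = \<sigma> ` {i \<in> J. \<psi> i = b}" using J by auto
    then show ?thesis
      using J(2) by (simp add: card_image inj_on_subset)
  qed
  have le: "\<bar>real (card {i \<in> I. \<psi> i = b}) - real (card {i \<in> I. \<theta> i = b})\<bar>
      \<le> real (card {i \<in> I - J. \<psi> i = b}) + real (card {i \<in> I - \<sigma> ` J. \<theta> i = b})" for b
    using split[OF J(1), of \<psi> b] split[OF J(3), of \<theta> b] matched[of b] by simp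
  have "((\<lambda>b. real (card {i \<in> I - J. \<psi> i = b}) + real (card {i \<in> I - \<sigma> ` J. \<theta> i = b})) has_sum
      (real (card (I - J)) + real (card (I - \<sigma> ` J)))) B"
    by (intro has_sum_add has_sum_card_fibres fin) (use assms in auto)
  also have "card (I - \<sigma> ` J) = card (I - J)"
    using J assms(1) fin by (simp add: card_Diff_subset card_image)
  finally have sum: "((\<lambda>b. real (card {i \<in> I - J. \<psi> i = b}) +
      real (card {i \<in> I - \<sigma> ` J. \<theta> i = b})) has_sum 2 * real (card (I - J))) B"
    by simp
  have "(\<Sum>\<^sub>\<infinity>b\<in>B. \<bar>real (card {i \<in> I. \<psi> i = b}) - real (card {i \<in> I. \<theta> i = b})\<bar>)
      \<le> (\<Sum>\<^sub>\<infinity>b\<in>B. real (card {i \<in> I - J. \<psi> i = b}) + real (card {i \<in> I - \<sigma> ` J. \<theta> i = b}))"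
  proof (intro infsum_mono)
    show "(\<lambda>b. real (card {i \<in> I - J. \<psi> i = b}) + real (card {i \<in> I - \<sigma> ` J. \<theta> i = b})) summable_on B"
      using sum by (rule has_sum_imp_summable)
    then show "(\<lambda>b. \<bar>real (card {i \<in> I. \<psi> i = b}) - real (card {i \<in> I. \<theta> i = b})\<bar>) summable_on B"
      by (rule summable_on_comparison_test) (use le in auto)
  qed (rule le)
  also have "\<dots> = 2 * real (card (I - J))" using sum by (rule infsumI)
  finally show ?thesis .
qed

text \<open>The top face in direction \<open>s\<close> is where raising that exponent leaves the
  box. Fixing one coordinate replaces one factor \<open>n\<close> of the cardinality by 1.\<close>

lemma card_PiE_face:
  assumes "finite S" "s \<in> S"
  shows "n * card {i \<in> PiE S (\<lambda>_. {..<n::nat}). i s = n - 1} = card (PiE S (\<lambda>_. {..<n}))"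
proof (cases "n = 0")
  case True
  then show ?thesis using assms by (simp add: card_PiE)
next
  case False
  have "{i \<in> PiE S (\<lambda>_. {..<n}). i s = n - 1} = PiE S (\<lambda>x. if x = s then {n - 1} else {..<n})"
    using assms False by (auto simp: PiE_iff extensional_def split: if_splits)
  then have "card {i \<in> PiE S (\<lambda>_. {..<n}). i s = n - 1} =
      (\<Prod>x\<in>S. card (if x = s then {n - 1} else {..<n}))"
    using assms by (simp add: card_PiE)
  also have "\<dots> = (\<Prod>x\<in>S - {s}. n)"
    using assms by (subst prod.remove[of S s]) auto
  finally show ?thesis
    using assms by (simp add: card_PiE power_eq_if[of n "card S"]) (metis card_gt_0_iff empty_iff gr_implies_not0)
qed

section \<open>The coefficient module and its semidirect product\<close>

lemma semidirect_simps [simp]: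
  "carrier (semidirect \<Gamma> \<Lambda>) = \<Gamma> \<times> \<Lambda>"
  "(a, \<mu>) \<otimes>\<^bsub>semidirect \<Gamma> \<Lambda>\<^esub> (b, \<kappa>) = (inverse \<kappa> * a + b, \<mu> * \<kappa>)"
  "\<one>\<^bsub>semidirect \<Gamma> \<Lambda>\<^esub> = (0, 1)"
  by (simp_all add: semidirect_def)

locale scaling_submodule =
  fixes \<Lambda> \<Gamma> :: "real set"
  assumes subgroup_\<Lambda>: "subgroup \<Lambda> pos_real_mult_group"
    and submodule: "real_submodule \<Lambda> \<Gamma>"
begin

abbreviation G :: "(real \<times> real) monoid" where "G \<equiv> semidirect \<Gamma> \<Lambda>"

lemma \<Lambda>_pos: "\<mu> \<in> \<Lambda> \<Longrightarrow> \<mu> > 0"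
  using subgroup.subset[OF subgroup_\<Lambda>] by (auto simp: pos_real_mult_group_def)

lemma \<Lambda>_one [simp]: "1 \<in> \<Lambda>"
  using subgroup.one_closed[OF subgroup_\<Lambda>] by (simp add: pos_real_mult_group_def)

lemma \<Lambda>_mult [simp]: "\<mu> \<in> \<Lambda> \<Longrightarrow> \<kappa> \<in> \<Lambda> \<Longrightarrow> \<mu> * \<kappa> \<in> \<Lambda>"
  using subgroup.m_closed[OF subgroup_\<Lambda>] by (simp add: pos_real_mult_group_def)

lemma \<Lambda>_inverse [simp]: "\<mu> \<in> \<Lambda> \<Longrightarrow> inverse \<mu> \<in> \<Lambda>"
proof -
  assume \<mu>: "\<mu> \<in> \<Lambda>"
  have "group pos_real_mult_group"
    by (rule groupI) (auto simp: pos_real_mult_group_def intro!: bexI[of _ "inverse _"])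
  then have "inv\<^bsub>pos_real_mult_group\<^esub> \<mu> = inverse \<mu>"
    by (rule group.inv_equality) (use \<Lambda>_pos[OF \<mu>] in \<open>auto simp: pos_real_mult_group_def\<close>)
  then show ?thesis
    using subgroup.m_inv_closed[OF subgroup_\<Lambda> \<mu>] by simp
qed

lemma subgroup_\<Gamma>: "subgroup \<Gamma> real_add_group"
  using submodule by (simp add: real_submodule_def)

lemma \<Gamma>_zero [simp]: "0 \<in> \<Gamma>"
  using subgroup.one_closed[OF subgroup_\<Gamma>] by (simp add: real_add_group_def)

lemma \<Gamma>_add [simp]: "a \<in> \<Gamma> \<Longrightarrow> b \<in> \<Gamma> \<Longrightarrow> a + b \<in> \<Gamma>"
  using subgroup.m_closed[OF subgroup_\<Gamma>] by (simp add: real_add_group_def)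

lemma \<Gamma>_minus [simp]: "a \<in> \<Gamma> \<Longrightarrow> - a \<in> \<Gamma>"
proof -
  assume a: "a \<in> \<Gamma>"
  have "group real_add_group"
    by (rule groupI) (auto simp: real_add_group_def intro!: exI[of _ "- _"])
  then have "inv\<^bsub>real_add_group\<^esub> a = - a"
    by (rule group.inv_equality) (auto simp: real_add_group_def)
  then show ?thesis
    using subgroup.m_inv_closed[OF subgroup_\<Gamma> a] by simp
qed

lemma \<Gamma>_diff [simp]: "a \<in> \<Gamma> \<Longrightarrow> b \<in> \<Gamma> \<Longrightarrow> a - b \<in> \<Gamma>"
  using \<Gamma>_add[of a "- b"] by simp

lemma \<Gamma>_add_iff [simp]: "c \<in> \<Gamma> \<Longrightarrow> t + c \<in> \<Gamma> \<longleftrightarrow> t \<in> \<Gamma>"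
  using \<Gamma>_diff[of "t + c" c] by auto

lemma \<Gamma>_scale [simp]: "\<mu> \<in> \<Lambda> \<Longrightarrow> a \<in> \<Gamma> \<Longrightarrow> \<mu> * a \<in> \<Gamma>"
  using submodule unfolding real_submodule_def by blast

lemma \<Gamma>_scale_iff [simp]: "\<mu> \<in> \<Lambda> \<Longrightarrow> \<mu> * a \<in> \<Gamma> \<longleftrightarrow> a \<in> \<Gamma>"
  using \<Gamma>_scale[of "inverse \<mu>" "\<mu> * a"] \<Lambda>_pos[of \<mu>] by (auto simp flip: mult.assoc)

lemma \<Gamma>_of_nat_mult [simp]: "a \<in> \<Gamma> \<Longrightarrow> real n * a \<in> \<Gamma>"
  by (induction n) (auto simp: algebra_simps)

lemma \<Gamma>_of_int_mult [simp]: "a \<in> \<Gamma> \<Longrightarrow> of_int n * a \<in> \<Gamma>"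
  by (cases n rule: int_cases2) auto

lemma \<Gamma>_sum: "(\<And>s. s \<in> S \<Longrightarrow> f s \<in> \<Gamma>) \<Longrightarrow> sum f S \<in> \<Gamma>"
  by (induction S rule: infinite_finite_induct) auto

lemma \<Lambda>_power [simp]: "\<mu> \<in> \<Lambda> \<Longrightarrow> \<mu> ^ n \<in> \<Lambda>"
  by (induction n) auto

lemma \<Lambda>_prod: "(\<And>s. s \<in> S \<Longrightarrow> f s \<in> \<Lambda>) \<Longrightarrow> prod f S \<in> \<Lambda>"
  by (induction S rule: infinite_finite_induct) auto

lemma group_G: "group G"
proof (rule groupI)
  fix x y z assume "x \<in> carrier G" "y \<in> carrier G" "z \<in> carrier G"
  then show "x \<otimes>\<^bsub>G\<^esub> y \<otimes>\<^bsub>G\<^esub> z = x \<otimes>\<^bsub>G\<^esub> (y \<otimes>\<^bsub>G\<^esub> z)"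
    by (cases x; cases y; cases z) (auto simp: algebra_simps)
next
  fix x assume "x \<in> carrier G"
  then obtain a \<mu> where x: "x = (a, \<mu>)" "a \<in> \<Gamma>" "\<mu> \<in> \<Lambda>" by auto
  then show "\<exists>y\<in>carrier G. y \<otimes>\<^bsub>G\<^esub> x = \<one>\<^bsub>G\<^esub>"
    using \<Lambda>_pos[of \<mu>] by (intro bexI[of _ "(- \<mu> * a, inverse \<mu>)"]) auto
qed auto

sublocale G: group G by (rule group_G)

text \<open>The index set is a box of exponents in the generators: the \<open>\<Lambda>\<close>-part runs through products
  of powers of the multipliers occurring in \<open>C\<close>, and the \<open>\<Gamma>\<close>-part through combinations of the
  finitely many twisted translations \<open>\<mu>\<^sup>-\<^sup>1c\<close> which left multiplication by \<open>C\<close> produces.\<close>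

lemma ex_almost_invariant_family:
  assumes "finite C" "C \<subseteq> carrier G" "n > 0"
  obtains I :: "((real \<Rightarrow> nat) \<times> (real \<Rightarrow> nat)) set" and \<phi>
  where "finite I" "I \<noteq> {}" "\<phi> ` I \<subseteq> carrier G"
    "\<And>g. g \<in> C \<Longrightarrow> \<exists>J \<sigma>. J \<subseteq> I \<and> inj_on \<sigma> J \<and> \<sigma> ` J \<subseteq> I \<and>
       (\<forall>i\<in>J. \<phi> (\<sigma> i) = g \<otimes>\<^bsub>G\<^esub> \<phi> i) \<and> n * card (I - J) \<le> 2 * card I"
proof -
  define T where "T = snd ` C"
  define A where "A = PiE T (\<lambda>_. {..<n})"
  define pr where "pr j = (\<Prod>t\<in>T. t ^ j t)" for j :: "real \<Rightarrow> nat"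
  \<comment> \<open>Left multiplication by \<open>(c, \<nu>)\<close> sends \<open>(a, pr j)\<close>
    to \<open>(inverse (pr j) * c + a, \<nu> * pr j)\<close>, so the translation it adds depends on
    \<open>j\<close>. The box \<open>A\<close> is therefore fixed before \<open>S\<close>, whose
    finiteness rests on that of \<open>A\<close>.\<close>
  define S where "S = (\<lambda>(c, j). inverse (pr j) * c) ` (fst ` C \<times> A)"
  define B where "B = PiE S (\<lambda>_. {..<n})"
  define sm where "sm i = (\<Sum>s\<in>S. real (i s) * s)" for i :: "real \<Rightarrow> nat"
  define \<phi> where "\<phi> = (\<lambda>(i, j). (sm i, pr j))"
  have T: "finite T" "T \<subseteq> \<Lambda>" using assms by (auto simp: T_def)
  have "finite A" unfolding A_def using T by (intro finite_PiE) auto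
  have pr: "pr j \<in> \<Lambda>" for j
    unfolding pr_def using T by (intro \<Lambda>_prod) auto
  have S: "finite S" "S \<subseteq> \<Gamma>"
    using \<open>finite A\<close> assms pr by (auto simp: S_def)
  have "finite B" unfolding B_def using S by (intro finite_PiE) auto
  have sm: "sm i \<in> \<Gamma>" for i
    unfolding sm_def using S by (intro \<Gamma>_sum) auto
  have sm_Suc: "sm (i(s := Suc (i s))) = sm i + s" if "s \<in> S" for i s
    using that S unfolding sm_def
    by (subst (1 2) sum.remove[of S s]) (auto simp: algebra_simps)
  have pr_Suc: "pr (j(t := Suc (j t))) = t * pr j" if "t \<in> T" for j t
    using that T unfolding pr_def
    by (subst (1 2) prod.remove[of T t]) (auto simp: algebra_simps)
  show thesis
  proof (rule that[of "B \<times> A" \<phi>])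
    show "finite (B \<times> A)" using \<open>finite A\<close> \<open>finite B\<close> by blast
    show "B \<times> A \<noteq> {}" using \<open>n > 0\<close> by (auto simp: A_def B_def PiE_eq_empty_iff)
    show "\<phi> ` (B \<times> A) \<subseteq> carrier G" using sm pr by (auto simp: \<phi>_def)
    fix g assume "g \<in> C"
    obtain c \<nu> where g: "g = (c, \<nu>)" by fastforce
    have \<nu>: "\<nu> \<in> T" using \<open>g \<in> C\<close> g by (force simp: T_def)
    define w where "w j = inverse (pr j) * c" for j
    have w: "w j \<in> S" if "j \<in> A" for j
      using that \<open>g \<in> C\<close> g by (force simp: S_def w_def)
    \<comment> \<open>Multiplication by \<open>g\<close> raises two exponents, one in direction
      \<open>w j\<close> and one in direction \<open>\<nu>\<close>; \<open>J\<close> consists of the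
      indices where neither is at its top value.\<close>
    define J where "J = {(i, j) \<in> B \<times> A. i (w j) \<noteq> n - 1 \<and> j \<nu> \<noteq> n - 1}"
    define \<sigma> where "\<sigma> = (\<lambda>(i, j). (i(w j := Suc (i (w j))), j(\<nu> := Suc (j \<nu>))))"
    have "inj_on \<sigma> J"
    proof (rule inj_onI, clarsimp simp: \<sigma>_def)
      fix i j i' j'
      assume *: "i(w j := Suc (i (w j))) = i'(w j' := Suc (i' (w j')))"
        "j(\<nu> := Suc (j \<nu>)) = j'(\<nu> := Suc (j' \<nu>))"
      have upd_inj: "p = q" if "p(x := Suc (p x)) = q(x := Suc (q x))" for p q :: "real \<Rightarrow> nat" and x
        using that by (metis Suc_inject fun_upd_eqD fun_upd_triv fun_upd_upd)
      \<comment> \<open>The second equation yields \<open>j = j'\<close>; only then do the updates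
        of \<open>i\<close> and \<open>i'\<close> concern the same coordinate.\<close>
      show "i = i' \<and> j = j'" using * upd_inj by metis
    qed
    moreover have "\<sigma> ` J \<subseteq> B \<times> A"
    proof
      fix x assume "x \<in> \<sigma> ` J"
      then obtain i j where x: "x = (i(w j := Suc (i (w j))), j(\<nu> := Suc (j \<nu>)))"
        and ij: "i \<in> B" "j \<in> A" "i (w j) \<noteq> n - 1" "j \<nu> \<noteq> n - 1"
        by (auto simp: J_def \<sigma>_def)
      have "i (w j) < n" "j \<nu> < n"
        using ij w[of j] \<nu> by (auto simp: A_def B_def PiE_iff)
      then have "Suc (i (w j)) < n" "Suc (j \<nu>) < n" using ij by linarith+
      then show "x \<in> B \<times> A"
        using ij w[of j] \<nu> unfolding x by (auto simp: A_def B_def PiE_iff extensional_def)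
    qed
    moreover have "\<phi> (\<sigma> x) = g \<otimes>\<^bsub>G\<^esub> \<phi> x" if "x \<in> J" for x
    proof -
      obtain i j where "x = (i, j)" "j \<in> A" using \<open>x \<in> J\<close> by (auto simp: J_def)
      then show ?thesis
        using sm_Suc[OF w] pr_Suc[OF \<nu>] by (simp add: \<phi>_def \<sigma>_def g w_def)
    qed
    moreover have "n * card (B \<times> A - J) \<le> 2 * card (B \<times> A)"
    proof -
      \<comment> \<open>The complement of \<open>J\<close> is a union of two faces, each an
        \<open>n\<close>-th of the box, whence the factor 2. The first face changes direction with
        \<open>j\<close>, so it is counted fibrewise over \<open>A\<close>.\<close>
      have "B \<times> A - J \<subseteq> (\<lambda>(j, i). (i, j)) ` (SIGMA j:A. {i \<in> B. i (w j) = n - 1}) \<union>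
          B \<times> {j \<in> A. j \<nu> = n - 1}"
        by (auto simp: J_def image_iff)
      then have "card (B \<times> A - J) \<le> card ((\<lambda>(j, i). (i, j)) ` (SIGMA j:A. {i \<in> B. i (w j) = n - 1}) \<union>
          B \<times> {j \<in> A. j \<nu> = n - 1})"
        using \<open>finite A\<close> \<open>finite B\<close> by (intro card_mono) auto
      also have "\<dots> \<le> card (SIGMA j:A. {i \<in> B. i (w j) = n - 1}) + card (B \<times> {j \<in> A. j \<nu> = n - 1})"
        using \<open>finite A\<close> \<open>finite B\<close>
        by (intro order_trans[OF card_Un_le] add_mono card_image_le) auto
      also have "\<dots> = (\<Sum>j\<in>A. card {i \<in> B. i (w j) = n - 1}) + card B * card {j \<in> A. j \<nu> = n - 1}"
        using \<open>finite A\<close> \<open>finite B\<close> by (simp add: card_cartesian_product)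
      finally have "n * card (B \<times> A - J) \<le>
          n * ((\<Sum>j\<in>A. card {i \<in> B. i (w j) = n - 1}) + card B * card {j \<in> A. j \<nu> = n - 1})"
        by (rule mult_left_mono) simp
      also have "\<dots> = (\<Sum>j\<in>A. n * card {i \<in> B. i (w j) = n - 1}) +
          card B * (n * card {j \<in> A. j \<nu> = n - 1})"
        by (simp add: algebra_simps sum_distrib_left)
      also have "(\<Sum>j\<in>A. n * card {i \<in> B. i (w j) = n - 1}) = (\<Sum>j\<in>A. card B)"
        unfolding B_def using S w by (intro sum.cong card_PiE_face) auto
      also have "n * card {j \<in> A. j \<nu> = n - 1} = card A"
        unfolding A_def using T \<nu> by (intro card_PiE_face) auto
      finally show ?thesis by (simp add: card_cartesian_product mult.commute[of "card A"])
    qed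
    ultimately show "\<exists>J \<sigma>. J \<subseteq> B \<times> A \<and> inj_on \<sigma> J \<and> \<sigma> ` J \<subseteq> B \<times> A \<and>
       (\<forall>i\<in>J. \<phi> (\<sigma> i) = g \<otimes>\<^bsub>G\<^esub> \<phi> i) \<and> n * card (B \<times> A - J) \<le> 2 * card (B \<times> A)"
      by (intro exI[of _ J] exI[of _ \<sigma>]) (auto simp: J_def)
  qed
qed

end

section \<open>The action on the split line\<close>

lemma split_proj_action [simp]: "split_proj (split_action (c, \<mu>) x) = \<mu> * (split_proj x + c)"
  by (cases x) auto

lemma split_action_one [simp]: "split_action (0, 1) x = x"
  by (cases x) auto

context scaling_submodule
begin

lemma split_action_closed:
  "g \<in> carrier G \<Longrightarrow> x \<in> split_line \<Gamma> \<Longrightarrow> split_action g x \<in> split_line \<Gamma>"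
  by (cases g; cases x) auto

text \<open>The twisted product encodes composition of affine maps: \<mu>(\<kappa>(t + b) + a) =
  \<mu>\<kappa>(t + a/\<kappa> + b).\<close>

lemma split_action_mult:
  assumes "g \<in> carrier G" "h \<in> carrier G"
  shows "split_action (g \<otimes>\<^bsub>G\<^esub> h) x = split_action g (split_action h x)"
  using assms \<Lambda>_pos[of "snd h"] by (cases g; cases h; cases x) (auto simp: field_simps)

lemma split_action_inv_cancel:
  assumes "g \<in> carrier G"
  shows "split_action (inv\<^bsub>G\<^esub> g) (split_action g x) = x"
    and "split_action g (split_action (inv\<^bsub>G\<^esub> g) x) = x"
proof -
  have "split_action (inv\<^bsub>G\<^esub> g \<otimes>\<^bsub>G\<^esub> g) x = x" "split_action (g \<otimes>\<^bsub>G\<^esub> inv\<^bsub>G\<^esub> g) x = x"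
    using assms by (simp_all only: G.l_inv G.r_inv semidirect_simps split_action_one)
  then show "split_action (inv\<^bsub>G\<^esub> g) (split_action g x) = x"
    "split_action g (split_action (inv\<^bsub>G\<^esub> g) x) = x"
    using assms G.inv_closed[OF assms] by (simp_all only: split_action_mult)
qed

text \<open>A translation with a fixed point is trivial, so \<open>snd g\<close> differs from 1 and
  the affine equation has a single solution. Writing it as a function of \<open>g\<close> alone lets
  the fixed points of all nontrivial elements be avoided at once.\<close>

lemma split_proj_fixed_point:
  assumes "g \<in> carrier G" "g \<noteq> \<one>\<^bsub>G\<^esub>" "split_action g x = x"
  shows "split_proj x = snd g * fst g / (1 - snd g)"
proof -
  obtain c \<mu> where g: "g = (c, \<mu>)" by fastforce
  have eq: "\<mu> * (split_proj x + c) = split_proj x"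
    using assms(3) split_proj_action[of c \<mu> x] by (simp add: g)
  with assms(2) have "\<mu> \<noteq> 1" by (auto simp: g)
  with eq show ?thesis by (simp add: g field_simps)
qed

lemma topologically_free:
  "topologically_free_action G (split_topology \<Gamma>) split_action"
  unfolding topologically_free_action_def
proof (rule ballI, rule ccontr)
  fix g assume g: "g \<in> carrier G - {\<one>\<^bsub>G\<^esub>}"
  define U where "U = split_topology \<Gamma> interior_of
    {x \<in> topspace (split_topology \<Gamma>). split_action g x = x}"
  assume "split_topology \<Gamma> interior_of
    {x \<in> topspace (split_topology \<Gamma>). split_action g x = x} \<noteq> {}"
  then have "openin (split_topology \<Gamma>) U" "U \<noteq> {}"
    by (simp_all add: U_def)
  then obtain s t where st: "s < t" "{x \<in> split_line \<Gamma>. s < split_proj x \<and> split_proj x < t} \<subseteq> U"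
    by (rule openin_split_contains_interval)
  have "U \<subseteq> {x. split_action g x = x}"
    unfolding U_def using interior_of_subset by fastforce
  then have "r = snd g * fst g / (1 - snd g)" if "s < r" "r < t" for r
    using ex_split_line_proj[of \<Gamma> r] split_proj_fixed_point[of g] g st(2) that by blast
  moreover obtain r where "s < r" "r < t" using dense[OF st(1)] by blast
  moreover obtain r' where "s < r'" "r' < r" using dense[OF \<open>s < r\<close>] by blast
  ultimately show False by (metis less_irrefl order_less_trans)
qed

end

section \<open>Consequences of density and countability\<close>

locale dense_scaling_submodule = scaling_submodule +
  assumes countable_\<Gamma>: "countable \<Gamma>" and dense_\<Gamma>: "closure \<Gamma> = UNIV"
begin

lemma ex_\<Gamma>_between:
  assumes "s < t"
  obtains c where "c \<in> \<Gamma>" "s < c" "c < t"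
proof -
  have "{s<..<t} \<inter> closure \<Gamma> \<noteq> {}"
    using assms dense_\<Gamma> by (simp add: greaterThanLessThan_empty_iff)
  then have "{s<..<t} \<inter> \<Gamma> \<noteq> {}"
    by (simp add: open_Int_closure_eq_empty)
  then show thesis using that by auto
qed

text \<open>Countability is given for \<Gamma> only; \<Lambda> inherits it through the injection
  \<open>\<mu> \<mapsto> \<mu> * c\<close> into \<Gamma> for a fixed nonzero
  \<open>c\<close>.\<close>

lemma countable_carrier: "countable (carrier G)"
proof -
  obtain c :: real where c: "c \<in> \<Gamma>" "0 < c" "c < 1" by (rule ex_\<Gamma>_between[of 0 1]) auto
  have "countable ((\<lambda>\<mu>. \<mu> * c) ` \<Lambda>)"
    by (rule countable_subset[OF _ countable_\<Gamma>]) (use c in auto)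
  moreover have "inj_on (\<lambda>\<mu>. \<mu> * c) \<Lambda>"
    using c by (auto simp: inj_on_def)
  ultimately have "countable \<Lambda>" by (rule countable_image_inj_on)
  with countable_\<Gamma> show ?thesis by simp
qed

text \<open>Density of \<Gamma> already makes the orbits under translations dense. The same
  translation serves the groupoid: if \<open>x\<close> lies in the interval and \<open>U\<close> is
  contained in it, it gives an arrow there.\<close>

lemma translate_into_open:
  assumes "openin (split_topology \<Gamma>) U" "U \<noteq> {}" "x \<in> split_line \<Gamma>"
  obtains c where "c \<in> \<Gamma>" "split_action (c, 1) x \<in> U"
proof -
  obtain s t where st: "s < t" "{x \<in> split_line \<Gamma>. s < split_proj x \<and> split_proj x < t} \<subseteq> U"
    using openin_split_contains_interval assms(1,2) by blast
  obtain c where c: "c \<in> \<Gamma>" "s - split_proj x < c" "c < t - split_proj x"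
    using ex_\<Gamma>_between[of "s - split_proj x" "t - split_proj x"] st by auto
  have "split_action (c, 1) x \<in> split_line \<Gamma>"
    using c assms(3) by (intro split_action_closed) auto
  then show thesis using that[of c] c st(2) by auto
qed

lemma minimal: "minimal_action G (split_topology \<Gamma>) split_action"
  unfolding minimal_action_def
proof
  fix x assume "x \<in> topspace (split_topology \<Gamma>)"
  then have x: "x \<in> split_line \<Gamma>" by simp
  have "\<exists>y. y \<in> orbit G split_action x \<and> y \<in> U"
    if U: "openin (split_topology \<Gamma>) U" "z \<in> U" for z U
  proof -
    obtain c where "c \<in> \<Gamma>" "split_action (c, 1) x \<in> U"
      using translate_into_open[OF U(1) _ x] U(2) by blast
    moreover have "(c, 1) \<in> carrier G" using \<open>c \<in> \<Gamma>\<close> by simp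
    ultimately show ?thesis unfolding orbit_def by blast
  qed
  then show "split_topology \<Gamma> closure_of orbit G split_action x = topspace (split_topology \<Gamma>)"
    by (auto simp: closure_of_def)
qed

section \<open>Reiter functions along an exhaustion of the group\<close>

definition almost_invariant ::
    "'i set \<Rightarrow> ('i \<Rightarrow> real \<times> real) \<Rightarrow> nat \<Rightarrow> real \<times> real \<Rightarrow> bool" where
  "almost_invariant I \<phi> n g \<longleftrightarrow> (\<exists>J \<sigma>. J \<subseteq> I \<and> inj_on \<sigma> J \<and> \<sigma> ` J \<subseteq> I \<and>
     (\<forall>i\<in>J. \<phi> (\<sigma> i) = g \<otimes>\<^bsub>G\<^esub> \<phi> i) \<and> n * card (I - J) \<le> 2 * card I)"

text \<open>An enumeration of the countable group yields increasing finite sets \<open>C n\<close>,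
  and every element lies in all but finitely many of them. The box length \<open>Suc n\<close> is
  positive for every \<open>n\<close>.\<close>

lemma ex_almost_invariant_sequence:
  obtains I :: "nat \<Rightarrow> ((real \<Rightarrow> nat) \<times> (real \<Rightarrow> nat)) set" and \<phi>
  where "\<And>n. finite (I n)" "\<And>n. I n \<noteq> {}" "\<And>n. \<phi> n ` I n \<subseteq> carrier G"
    "\<And>g. g \<in> carrier G \<Longrightarrow> \<forall>\<^sub>F n in sequentially. almost_invariant (I n) (\<phi> n) (Suc n) g"
proof -
  define C where "C n = from_nat_into (carrier G) ` {..n}" for n
  have ne: "carrier G \<noteq> {}" using G.one_closed by blast
  have C: "finite (C n)" "C n \<subseteq> carrier G" for n
    unfolding C_def by (auto simp del: semidirect_simps intro: from_nat_into[OF ne])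
  have "\<exists>(I :: ((real \<Rightarrow> nat) \<times> (real \<Rightarrow> nat)) set) \<phi>. finite I \<and> I \<noteq> {} \<and> \<phi> ` I \<subseteq> carrier G \<and>
      (\<forall>g\<in>C n. almost_invariant I \<phi> (Suc n) g)" for n
    using ex_almost_invariant_family[OF C, of "Suc n" n] unfolding almost_invariant_def
    by (metis zero_less_Suc)
  then obtain I :: "nat \<Rightarrow> ((real \<Rightarrow> nat) \<times> (real \<Rightarrow> nat)) set" and \<phi>
    where *: "\<And>n. finite (I n) \<and> I n \<noteq> {} \<and> \<phi> n ` I n \<subseteq> carrier G \<and>
      (\<forall>g\<in>C n. almost_invariant (I n) (\<phi> n) (Suc n) g)"
    by metis
  have "\<forall>\<^sub>F n in sequentially. almost_invariant (I n) (\<phi> n) (Suc n) g" if g: "g \<in> carrier G" for g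
  proof -
    obtain m where "g = from_nat_into (carrier G) m"
      using from_nat_into_surj[OF countable_carrier g] by blast
    then have "g \<in> C n" if "n \<ge> m" for n using that by (auto simp: C_def)
    then show ?thesis using * unfolding eventually_sequentially by blast
  qed
  then show thesis using that * by blast
qed

text \<open>At most \<open>2 * card I / n\<close> indices are unmatched; they count on both sides,
  and dividing by \<open>card I\<close> leaves \<open>4 / n\<close>. The map \<open>p\<close> will
  be the identity for the action and \<open>coset_arrow u\<close> for the groupoid.\<close>

lemma almost_invariant_infsum_le:
  assumes "finite I" "I \<noteq> {}" "\<phi> ` I \<subseteq> carrier G" "n > 0" "almost_invariant I \<phi> n g"
    and "g \<in> carrier G" "p ` carrier G \<subseteq> B"
  shows "(\<Sum>\<^sub>\<infinity>b\<in>B. \<bar>real (card {i \<in> I. p (g \<otimes>\<^bsub>G\<^esub> \<phi> i) = b}) / real (card I) -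
           real (card {i \<in> I. p (\<phi> i) = b}) / real (card I)\<bar>) \<le> 4 / real n"
proof -
  obtain J \<sigma> where J: "J \<subseteq> I" "inj_on \<sigma> J" "\<sigma> ` J \<subseteq> I" "\<And>i. i \<in> J \<Longrightarrow> \<phi> (\<sigma> i) = g \<otimes>\<^bsub>G\<^esub> \<phi> i"
    and card: "n * card (I - J) \<le> 2 * card I"
    using assms(5) unfolding almost_invariant_def by blast
  have "card I > 0" using assms(1,2) by (simp add: card_gt_0_iff)
  have "real n * real (card (I - J)) \<le> 2 * real (card I)"
    using card by (metis of_nat_le_iff of_nat_mult of_nat_numeral)
  then have "2 * real (card (I - J)) * inverse (real (card I)) \<le> 4 / real n"
    using \<open>n > 0\<close> \<open>card I > 0\<close> by (simp add: field_simps)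
  moreover have "(\<Sum>\<^sub>\<infinity>b\<in>B. \<bar>real (card {i \<in> I. p (g \<otimes>\<^bsub>G\<^esub> \<phi> i) = b}) -
           real (card {i \<in> I. p (\<phi> i) = b})\<bar>) \<le> 2 * real (card (I - J))"
  proof (rule infsum_card_fibres_diff_le[OF assms(1) _ _ J(1-3)])
    have "\<phi> i \<in> carrier G" if "i \<in> I" for i using assms(3) that by blast
    then show "(\<lambda>i. p (g \<otimes>\<^bsub>G\<^esub> \<phi> i)) ` I \<subseteq> B" "(\<lambda>i. p (\<phi> i)) ` I \<subseteq> B"
      using assms(6,7) G.m_closed by blast+
  qed (simp add: J(4))
  ultimately have "(\<Sum>\<^sub>\<infinity>b\<in>B. \<bar>real (card {i \<in> I. p (g \<otimes>\<^bsub>G\<^esub> \<phi> i) = b}) -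
           real (card {i \<in> I. p (\<phi> i) = b})\<bar>) * inverse (real (card I)) \<le> 4 / real n"
    by (meson inverse_nonnegative_iff_nonnegative mult_right_mono of_nat_0_le_iff order_trans)
  also have "(\<Sum>\<^sub>\<infinity>b\<in>B. \<bar>real (card {i \<in> I. p (g \<otimes>\<^bsub>G\<^esub> \<phi> i) = b}) -
           real (card {i \<in> I. p (\<phi> i) = b})\<bar>) * inverse (real (card I)) =
     (\<Sum>\<^sub>\<infinity>b\<in>B. \<bar>real (card {i \<in> I. p (g \<otimes>\<^bsub>G\<^esub> \<phi> i) = b}) / real (card I) -
           real (card {i \<in> I. p (\<phi> i) = b}) / real (card I)\<bar>)"
    using \<open>card I > 0\<close>
    by (subst infsum_cmult_left'[symmetric], intro infsum_cong)
       (simp add: divide_inverse abs_mult flip: left_diff_distrib)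
  finally show ?thesis .
qed

lemma eventually_almost_invariant:
  assumes "\<And>g. g \<in> carrier G \<Longrightarrow> \<forall>\<^sub>F n in sequentially. almost_invariant (I n) (\<phi> n) (Suc n) g"
    and "finite C" "C \<subseteq> carrier G" "e > (0::real)"
  shows "\<forall>\<^sub>F n in sequentially. 4 / real (Suc n) < e \<and> (\<forall>g\<in>C. almost_invariant (I n) (\<phi> n) (Suc n) g)"
proof (intro eventually_conj eventually_ball_finite assms(2) ballI)
  have "(\<lambda>n. 4 / real (Suc n)) \<longlonglongrightarrow> 0"
    by (intro LIMSEQ_Suc lim_const_over_n)
  then show "\<forall>\<^sub>F n in sequentially. 4 / real (Suc n) < e"
    by (rule order_tendstoD) (rule assms(4))
qed (use assms in auto)

lemma amenable: "amenable_action G (split_topology \<Gamma>) split_action"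
proof -
  obtain I :: "nat \<Rightarrow> ((real \<Rightarrow> nat) \<times> (real \<Rightarrow> nat)) set" and \<phi>
    where I: "\<And>n. finite (I n)" "\<And>n. I n \<noteq> {}" "\<And>n. \<phi> n ` I n \<subseteq> carrier G"
    and inv: "\<And>g. g \<in> carrier G \<Longrightarrow>
      \<forall>\<^sub>F n in sequentially. almost_invariant (I n) (\<phi> n) (Suc n) g"
    by (rule ex_almost_invariant_sequence) (rule that)
  define m where "m n = (\<lambda>(x :: split_point) h. real (card {i \<in> I n. \<phi> n i = h}) / real (card (I n)))"
    for n
  have "m n x \<in> prob_functions G" for n x
    unfolding m_def prob_functions_def using has_sum_card_fibres_normalised[OF I] by auto
  moreover have "continuous_map (split_topology \<Gamma>) euclideanreal (\<lambda>x. m n x h)" for n h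
    by (simp add: m_def)
  moreover have "uniform_limit K
       (\<lambda>m (g, x). \<Sum>\<^sub>\<infinity>h\<in>carrier G. \<bar>m x (inv\<^bsub>G\<^esub> g \<otimes>\<^bsub>G\<^esub> h) - m (split_action g x) h\<bar>)
       (\<lambda>_. 0) (filtermap m sequentially)"
    if K: "compactin (prod_topology (discrete_topology (carrier G)) (split_topology \<Gamma>)) K" for K
    unfolding uniform_limit_iff eventually_filtermap
  proof (intro allI impI)
    fix e :: real assume "e > 0"
    \<comment> \<open>A compact set involves only finitely many group elements, so uniformity over
      \<open>K\<close> reduces to finitely many eventual statements.\<close>
    have "compactin (discrete_topology (carrier G)) (fst ` K)"
      using K continuous_map_fst by (rule image_compactin)
    then have fst_K: "finite (fst ` K)" "fst ` K \<subseteq> carrier G"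
      by (simp_all add: compactin_discrete_topology)
    have eventually: "\<forall>\<^sub>F n in sequentially. 4 / real (Suc n) < e \<and>
        (\<forall>g\<in>fst ` K. almost_invariant (I n) (\<phi> n) (Suc n) g)"
      by (rule eventually_almost_invariant[OF _ fst_K \<open>e > 0\<close>]) (rule inv)
    show "\<forall>\<^sub>F n in sequentially. \<forall>x\<in>K. dist (case x of (g, x) \<Rightarrow>
        \<Sum>\<^sub>\<infinity>h\<in>carrier G. \<bar>m n x (inv\<^bsub>G\<^esub> g \<otimes>\<^bsub>G\<^esub> h) - m n (split_action g x) h\<bar>) 0 < e"
      using eventually
    proof eventually_elim
      case (elim n)
      show ?case
      proof (clarify)
        fix g x assume "(g, x) \<in> K"
        then have g: "g \<in> carrier G" "almost_invariant (I n) (\<phi> n) (Suc n) g"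
          using fst_K elim by force+
        have "{i \<in> I n. \<phi> n i = inv\<^bsub>G\<^esub> g \<otimes>\<^bsub>G\<^esub> h} = {i \<in> I n. g \<otimes>\<^bsub>G\<^esub> \<phi> n i = h}"
          if "h \<in> carrier G" for h
          using that g(1) I(3)[of n] G.inv_solve_left by (smt (verit) Collect_cong image_subset_iff)
        then have "(\<Sum>\<^sub>\<infinity>h\<in>carrier G. \<bar>m n x (inv\<^bsub>G\<^esub> g \<otimes>\<^bsub>G\<^esub> h) - m n (split_action g x) h\<bar>) =
          (\<Sum>\<^sub>\<infinity>h\<in>carrier G. \<bar>real (card {i \<in> I n. g \<otimes>\<^bsub>G\<^esub> \<phi> n i = h}) / real (card (I n)) -
           real (card {i \<in> I n. \<phi> n i = h}) / real (card (I n))\<bar>)"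
          unfolding m_def by (intro infsum_cong) (simp only:)
        also have "\<dots> \<le> 4 / real (Suc n)"
          using almost_invariant_infsum_le[OF I(1,2,3) _ g(2,1), of "\<lambda>h. h" "carrier G"] by simp
        also have "\<dots> < e" using elim by blast
        finally show "dist (\<Sum>\<^sub>\<infinity>h\<in>carrier G. \<bar>m n x (inv\<^bsub>G\<^esub> g \<otimes>\<^bsub>G\<^esub> h) - m n (split_action g x) h\<bar>) 0 < e"
          by (simp add: dist_real_def infsum_nonneg)
      qed
    qed
  qed
  ultimately show ?thesis
    unfolding amenable_action_def
    by (intro exI[of _ "filtermap m sequentially"]) (simp add: eventually_filtermap filtermap_bot_iff)
qed

end

section \<open>The reduced transformation groupoid\<close>

locale split_interval_groupoid = dense_scaling_submodule +
  fixes l :: real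
  assumes l_mem: "l \<in> \<Gamma>" and l_pos: "l > 0"
begin

abbreviation Y :: "split_point set" where "Y \<equiv> split_interval \<Gamma> (Plus 0) (Minus l)"
abbreviation \<G> :: "(split_point, (real \<times> real) \<times> split_point) top_groupoid" where
  "\<G> \<equiv> split_groupoid \<Gamma> \<Lambda> l"

lemma Y_subset: "Y \<subseteq> split_line \<Gamma>"
  by (auto simp: split_interval_def)

lemma topspace_arrows:
  "topspace (arrows \<G>) = {(g, x). g \<in> carrier G \<and> x \<in> Y \<and> split_action g x \<in> Y}"
  using Y_subset by (auto simp: split_groupoid_def restricted_transformation_groupoid_def)

lemma units_eq: "units \<G> = subtopology (split_topology \<Gamma>) Y"
  by (simp add: split_groupoid_def restricted_transformation_groupoid_def)

lemma topspace_units: "topspace (units \<G>) = Y"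
  using Y_subset by (auto simp: units_eq)

lemma groupoid_simps [simp]:
  "gsource \<G> (g, x) = x" "grange \<G> (g, x) = split_action g x"
  "gident \<G> x = (\<one>\<^bsub>G\<^esub>, x)" "gcomp \<G> (g, y) (h, x) = (g \<otimes>\<^bsub>G\<^esub> h, x)"
  "ginv \<G> (g, x) = (inv\<^bsub>G\<^esub> g, split_action g x)"
  by (simp_all add: split_groupoid_def restricted_transformation_groupoid_def)

lemma openin_units: "openin (units \<G>) U \<longleftrightarrow> openin (split_topology \<Gamma>) U \<and> U \<subseteq> Y"
  unfolding units_eq using openin_split_interval[OF \<Gamma>_zero l_mem]
  by (rule openin_open_subtopology)

lemma closure_of_units_eqI:
  assumes "\<And>U. openin (split_topology \<Gamma>) U \<Longrightarrow> U \<noteq> {} \<Longrightarrow> U \<subseteq> Y \<Longrightarrow> \<exists>x\<in>U. x \<in> A"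
  shows "units \<G> closure_of A = topspace (units \<G>)"
proof -
  have "\<exists>y. y \<in> A \<and> y \<in> U" if "x \<in> U" "openin (units \<G>) U" for x U
    using assms[of U] that by (auto simp: openin_units)
  then show ?thesis unfolding closure_of_def by blast
qed

text \<open>Countably many group elements rule out only countably many reals, while the interval
  under an open set is uncountable. A point over a remaining real has trivial isotropy, without
  recourse to Baire category.\<close>

lemma topologically_principal: "topologically_principal \<G>"
  unfolding topologically_principal_def
proof (rule closure_of_units_eqI)
  fix U assume U: "openin (split_topology \<Gamma>) U" "U \<noteq> {}" "U \<subseteq> Y"
  then obtain s t where st: "s < t" "{x \<in> split_line \<Gamma>. s < split_proj x \<and> split_proj x < t} \<subseteq> U"
    using openin_split_contains_interval by blast
  have "countable ((\<lambda>g. snd g * fst g / (1 - snd g)) ` carrier G)"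
    using countable_carrier by (rule countable_image)
  then obtain r where r: "s < r" "r < t" "r \<notin> (\<lambda>g. snd g * fst g / (1 - snd g)) ` carrier G"
    using uncountable_open_interval[of s t] st(1) countable_subset
    by (metis (no_types, lifting) greaterThanLessThan_iff subsetI)
  obtain u where u: "u \<in> split_line \<Gamma>" "split_proj u = r" using ex_split_line_proj by blast
  have "u \<in> U" using u r st(2) by blast
  have "g = \<one>\<^bsub>G\<^esub>" if "g \<in> carrier G" "split_action g u = u" for g
    using split_proj_fixed_point[OF that(1) _ that(2)] r(3) u(2) that(1) by blast
  then have "isotropy \<G> u \<subseteq> {gident \<G> u}"
    unfolding isotropy_def topspace_arrows by (auto simp del: semidirect_simps)
  moreover have "gident \<G> u \<in> isotropy \<G> u"
    using \<open>u \<in> U\<close> U(3) unfolding isotropy_def topspace_arrows by auto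
  ultimately show "\<exists>x\<in>U. x \<in> {u \<in> topspace (units \<G>). isotropy \<G> u = {gident \<G> u}}"
    using \<open>u \<in> U\<close> U(3) unfolding topspace_units by blast
qed

lemma minimal_groupoid: "minimal_groupoid \<G>"
  unfolding minimal_groupoid_def
proof (intro ballI closure_of_units_eqI)
  fix x U assume x: "x \<in> topspace (units \<G>)"
    and U: "openin (split_topology \<Gamma>) U" "U \<noteq> {}" "U \<subseteq> Y"
  then have "x \<in> Y" by (simp add: topspace_units)
  obtain c where c: "c \<in> \<Gamma>" "split_action (c, 1) x \<in> U"
    using translate_into_open[OF U(1,2)] \<open>x \<in> Y\<close> Y_subset by blast
  have "((c, 1), x) \<in> {a \<in> topspace (arrows \<G>). gsource \<G> a = x}"
    using c U(3) \<open>x \<in> Y\<close> unfolding topspace_arrows by auto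
  then have "grange \<G> ((c, 1), x) \<in> groupoid_orbit \<G> x"
    unfolding groupoid_orbit_def by (rule imageI)
  then show "\<exists>y\<in>U. y \<in> groupoid_orbit \<G> x" using c by auto
qed

text \<open>Over 0 the set \<open>Y\<close> keeps only the right copy and over \<open>l\<close> only
  the left one, so adjacent translates meet over a common end point without sharing a point or
  missing one.\<close>

lemma ex1_translate_into_Y:
  assumes "z \<in> split_line \<Gamma>"
  shows "\<exists>!n::int. split_action (of_int n * l, 1) z \<in> Y"
proof (rule ex_ex1I)
  define p where "p = split_proj z"
  \<comment> \<open>This is the index of the cell over \<open>[n * l, (n + 1) * l]\<close>
    containing \<open>z\<close>. The two formulas differ only when \<open>p\<close> is a multiple of
    \<open>l\<close>: its left copy belongs to the cell that ends there.\<close>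
  define n where "n = (if z = Minus p then \<lceil>p / l\<rceil> - 1 else \<lfloor>p / l\<rfloor>)"
  have le: "of_int n * l \<le> p \<and> p \<le> of_int (n + 1) * l"
  proof -
    have "of_int n \<le> p / l"
      by (cases "z = Minus p") (simp add: n_def; linarith)+
    moreover have "p / l \<le> of_int (n + 1)"
      by (cases "z = Minus p") (simp add: n_def; linarith)+
    ultimately show ?thesis using l_pos by (simp add: field_simps)
  qed
  have left: "of_int n * l \<noteq> p" if "z = Minus p"
  proof -
    have "of_int n < p / l" using that by (simp add: n_def; linarith)
    then show ?thesis using l_pos by (simp add: field_simps)
  qed
  have right: "of_int (n + 1) * l \<noteq> p" if "z \<noteq> Minus p"
  proof -
    have "p / l < of_int (n + 1)" using that by (simp add: n_def; linarith)
    then show ?thesis using l_pos by (simp add: field_simps)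
  qed
  have regular: "p \<noteq> of_int k * l" if "z = Reg p" for k
    using assms that l_mem by auto
  have "split_action (of_int (- n) * l, 1) z \<in> Y"
    unfolding mem_split_interval_Plus_Minus
  proof (intro conjI)
    show "split_action (of_int (- n) * l, 1) z \<in> split_line \<Gamma>"
      using assms l_mem by (intro split_action_closed) (auto intro: \<Gamma>_of_int_mult[of l "- n", simplified])
    show "0 \<le> split_proj (split_action (of_int (- n) * l, 1) z)"
      "split_proj (split_action (of_int (- n) * l, 1) z) \<le> l"
      using le by (simp_all add: p_def algebra_simps)
    show "split_action (of_int (- n) * l, 1) z \<noteq> Minus 0"
      using left by (cases z) (auto simp: p_def)
    show "split_action (of_int (- n) * l, 1) z \<noteq> Reg 0"
      using regular[of n] by (cases z) (auto simp: p_def)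
    show "split_action (of_int (- n) * l, 1) z \<noteq> Reg l"
      using regular[of "n + 1"] by (cases z) (auto simp: p_def algebra_simps)
    show "split_action (of_int (- n) * l, 1) z \<noteq> Plus l"
      using right by (cases z) (auto simp: p_def algebra_simps)
  qed
  then show "\<exists>n::int. split_action (of_int n * l, 1) z \<in> Y" by blast
next
  fix m n :: int
  have le: "j \<le> k" if "split_action (of_int j * l, 1) z \<in> Y" "split_action (of_int k * l, 1) z \<in> Y"
    for j k :: int
  proof (rule ccontr)
    assume "\<not> j \<le> k"
    then have "real_of_int j \<ge> of_int k + 1" by linarith
    then have "(of_int k + 1) * l \<le> of_int j * l" using l_pos by (intro mult_right_mono) auto
    moreover have "split_proj z + of_int j * l \<le> l" "split_proj z + of_int k * l \<ge> 0"
      using that unfolding mem_split_interval_Plus_Minus by auto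
    \<comment> \<open>Two different translates in \<open>Y\<close> would have to sit at its opposite
      ends, making \<open>z\<close> a left and a right copy at once.\<close>
    ultimately have "split_proj z + of_int j * l = l" "split_proj z + of_int k * l = 0"
      by (simp_all add: algebra_simps)
    then show False
      using that unfolding mem_split_interval_Plus_Minus by (cases z) auto
  qed
  assume "split_action (of_int m * l, 1) z \<in> Y" "split_action (of_int n * l, 1) z \<in> Y"
  then show "m = n" using le by (simp add: order_antisym)
qed

section \<open>Left cosets of the translations by multiples of l, and range fibres\<close>

definition same_coset :: "real \<times> real \<Rightarrow> real \<times> real \<Rightarrow> bool" where
  "same_coset g k \<longleftrightarrow> snd g = snd k \<and> (\<exists>n::int. fst k = fst g + of_int n * l)"

text \<open>For elements with the same \<open>snd\<close>, left multiplication by \<open>h\<close>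
  shifts both first components by the same amount, so their difference is preserved.\<close>

lemma same_coset_mult_left:
  "same_coset (h \<otimes>\<^bsub>G\<^esub> g) (h \<otimes>\<^bsub>G\<^esub> k) \<longleftrightarrow> same_coset g k" if "h \<in> carrier G"
  using that \<Lambda>_pos[of "snd h"] by (cases g; cases h; cases k) (auto simp: same_coset_def)

lemma mem_range_fibre:
  "(k, y) \<in> range_fibre \<G> u \<longleftrightarrow> k \<in> carrier G \<and> y \<in> Y \<and> u \<in> Y \<and> split_action k y = u"
  unfolding range_fibre_def topspace_arrows by auto

text \<open>With \<open>z\<close> the preimage of \<open>u\<close> under \<open>g\<close>, an arrow
  into \<open>u\<close> with group part \<open>g \<otimes> \<tau> m\<close> must start at the
  translate of \<open>z\<close> by \<open>\<tau> (- m)\<close>. That translate lies in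
  \<open>Y\<close> for exactly one \<open>m\<close>.\<close>

lemma ex1_arrow_in_coset:
  assumes u: "u \<in> Y" and g: "g \<in> carrier G"
  shows "\<exists>!b. b \<in> range_fibre \<G> u \<and> same_coset g (fst b)"
proof -
  define \<tau> where "\<tau> n = (real_of_int n * l, 1::real)" for n
  have \<tau>: "\<tau> n \<in> carrier G" for n using l_mem by (simp add: \<tau>_def)
  have \<tau>_inv: "split_action (\<tau> n) (split_action (\<tau> (- n)) x) = x" for n x
    by (cases x) (auto simp: \<tau>_def)
  have coset: "same_coset g k \<longleftrightarrow> (\<exists>n. k = g \<otimes>\<^bsub>G\<^esub> \<tau> n)" for k
    by (cases g; cases k) (auto simp: same_coset_def \<tau>_def)
  define z where "z = split_action (inv\<^bsub>G\<^esub> g) u"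
  have gz: "split_action g z = u" unfolding z_def by (rule split_action_inv_cancel[OF g])
  have "z \<in> split_line \<Gamma>"
    unfolding z_def using u Y_subset G.inv_closed[OF g] by (blast intro: split_action_closed)
  then obtain n where n: "split_action (\<tau> n) z \<in> Y"
    and n_unique: "\<And>m. split_action (\<tau> m) z \<in> Y \<Longrightarrow> m = n"
    using ex1_translate_into_Y[of z] unfolding \<tau>_def by blast
  have act: "split_action (g \<otimes>\<^bsub>G\<^esub> \<tau> m) y = u \<longleftrightarrow> y = split_action (\<tau> (- m)) z" for m y
    by (metis \<tau> \<tau>_inv add.inverse_inverse g gz split_action_inv_cancel(1) split_action_mult)
  show ?thesis
  proof (rule ex1I[of _ "(g \<otimes>\<^bsub>G\<^esub> \<tau> (- n), split_action (\<tau> n) z)"])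
    show "(g \<otimes>\<^bsub>G\<^esub> \<tau> (- n), split_action (\<tau> n) z) \<in> range_fibre \<G> u \<and>
        same_coset g (fst (g \<otimes>\<^bsub>G\<^esub> \<tau> (- n), split_action (\<tau> n) z))"
      using G.m_closed[OF g \<tau>] n u act by (auto simp: mem_range_fibre coset simp del: semidirect_simps)
    fix b assume b: "b \<in> range_fibre \<G> u \<and> same_coset g (fst b)"
    obtain k y where ky: "b = (k, y)" by fastforce
    then obtain m where m: "k = g \<otimes>\<^bsub>G\<^esub> \<tau> m" using b coset by auto
    with b ky have "y \<in> Y" "y = split_action (\<tau> (- m)) z"
      by (auto simp: mem_range_fibre act)
    then have "- m = n" using n_unique by blast
    then show "b = (g \<otimes>\<^bsub>G\<^esub> \<tau> (- n), split_action (\<tau> n) z)"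
      using ky m \<open>y = _\<close> by auto
  qed
qed

definition coset_arrow :: "split_point \<Rightarrow> real \<times> real \<Rightarrow> (real \<times> real) \<times> split_point" where
  "coset_arrow u g = (THE b. b \<in> range_fibre \<G> u \<and> same_coset g (fst b))"

text \<open>The second part turns counting indices in a coset into counting the fibres of a map into
  the range fibre, to which the counting lemmas apply.\<close>

lemma coset_arrow:
  assumes "u \<in> Y" "g \<in> carrier G"
  shows "coset_arrow u g \<in> range_fibre \<G> u"
    and "b \<in> range_fibre \<G> u \<Longrightarrow> same_coset g (fst b) \<longleftrightarrow> coset_arrow u g = b"
  using theI'[OF ex1_arrow_in_coset[OF assms]] ex1_arrow_in_coset[OF assms]
  unfolding coset_arrow_def by blast+

text \<open>An element \<open>k\<close> acts by an increasing affine map, so the preimage of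
  \<open>Y\<close> is an interval of the same kind. Intersecting with \<open>Y\<close> keeps the end
  points in \<Gamma>; an empty result is compact as well.\<close>

lemma compact_return_set:
  assumes "k \<in> carrier G"
  shows "compactin (split_topology \<Gamma>) {y \<in> Y. split_action k y \<in> Y}"
proof -
  obtain c \<mu> where k: "k = (c, \<mu>)" "c \<in> \<Gamma>" "\<mu> \<in> \<Lambda>" using assms by auto
  have "\<mu> > 0" using k \<Lambda>_pos by blast
  have "{y \<in> Y. split_action k y \<in> Y} =
      split_interval \<Gamma> (Plus (max 0 (- c))) (Minus (min l (inverse \<mu> * l - c)))" (is "?L = ?R")
  proof (rule Set.set_eqI)
    fix y
    define p where "p = split_proj y"
    have "0 \<le> \<mu> * (p + c) \<longleftrightarrow> - c \<le> p" "\<mu> * (p + c) = 0 \<longleftrightarrow> p = - c"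
      using \<open>\<mu> > 0\<close> by (auto simp: zero_le_mult_iff)
    moreover have "\<mu> * (p + c) \<le> l \<longleftrightarrow> p \<le> inverse \<mu> * l - c"
      "\<mu> * (p + c) = l \<longleftrightarrow> p = inverse \<mu> * l - c"
      using \<open>\<mu> > 0\<close> by (auto simp: field_simps)
    ultimately show "y \<in> ?L \<longleftrightarrow> y \<in> ?R"
      using k l_mem unfolding mem_Collect_eq mem_split_interval_Plus_Minus
      by (cases y) (auto simp: p_def max_def min_def)
  qed
  moreover have "max 0 (- c) \<in> \<Gamma>" "min l (inverse \<mu> * l - c) \<in> \<Gamma>"
    using k l_mem by (auto simp: max_def min_def)
  ultimately show ?thesis using compactin_split_interval by simp
qed

lemma finite_coset_return:
  assumes "g \<in> carrier G"
  shows "finite {k. same_coset g k \<and> (\<exists>y\<in>Y. split_action k y \<in> Y)}"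
proof -
  obtain c \<mu> where g: "g = (c, \<mu>)" "\<mu> > 0" using assms \<Lambda>_pos by auto
  \<comment> \<open>From \<open>y\<close> over \<open>[0, l]\<close> and \<open>y + a\<close> over
    \<open>[0, l / \<mu>]\<close> it follows that \<open>a = c + n * l\<close> lies between
    \<open>- l\<close> and \<open>l / \<mu>\<close>.\<close>
  define N where "N = {\<lfloor>(- c - l) / l\<rfloor>..\<lceil>(l / \<mu> - c) / l\<rceil>}"
  have "{k. same_coset g k \<and> (\<exists>y\<in>Y. split_action k y \<in> Y)} \<subseteq> (\<lambda>n. (c + of_int n * l, \<mu>)) ` N"
  proof clarify
    fix a \<nu> y assume *: "same_coset g (a, \<nu>)" "y \<in> Y" "split_action (a, \<nu>) y \<in> Y"
    then obtain n :: int where n: "\<nu> = \<mu>" "a = c + of_int n * l"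
      by (auto simp: same_coset_def g)
    have p: "0 \<le> split_proj y" "split_proj y \<le> l" "0 \<le> \<mu> * (split_proj y + a)"
      "\<mu> * (split_proj y + a) \<le> l"
      using *(2,3) unfolding mem_split_interval_Plus_Minus n(1) by auto
    have "0 \<le> split_proj y + a"
      using p(3) g(2) by (simp add: zero_le_mult_iff)
    moreover have "split_proj y + a \<le> l / \<mu>"
      using p(4) g(2) by (simp add: field_simps)
    ultimately have "- c - l \<le> of_int n * l" "of_int n * l \<le> l / \<mu> - c"
      using p(1,2) n by linarith+
    then have "(- c - l) / l \<le> of_int n" "of_int n \<le> (l / \<mu> - c) / l"
      using l_pos by (simp_all add: pos_divide_le_eq pos_le_divide_eq)
    then have "n \<in> N" unfolding N_def by (auto simp: floor_le_iff le_ceiling_iff)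
    then show "(a, \<nu>) \<in> (\<lambda>n. (c + of_int n * l, \<mu>)) ` N" using n by blast
  qed
  then show ?thesis by (rule finite_subset) (simp add: N_def)
qed

text \<open>Continuity is free, since the function depends on the discrete coordinate only. On the
  group it charges whole infinite cosets; compact support appears because only finitely many
  elements of a coset carry a point of \<open>Y\<close> back into \<open>Y\<close>, each on a
  compact set.\<close>

lemma coset_count_nonneg_Cc:
  fixes \<phi> :: "'i \<Rightarrow> real \<times> real"
  assumes "finite I" "\<phi> ` I \<subseteq> carrier G"
  shows "(\<lambda>a. real (card {i \<in> I. same_coset (\<phi> i) (fst a)}) / real (card I)) \<in> nonneg_Cc (arrows \<G>)"
proof -
  define X where "X = prod_topology (discrete_topology (carrier G)) (split_topology \<Gamma>)"
  have arrows: "arrows \<G> = subtopology X {(g, x). g \<in> carrier G \<and> x \<in> Y \<and> split_action g x \<in> Y}"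
    by (simp add: X_def split_groupoid_def restricted_transformation_groupoid_def)
  define f where "f k = real (card {i \<in> I. same_coset (\<phi> i) k}) / real (card I)" for k
  have "continuous_map (discrete_topology (carrier G)) euclideanreal f" by simp
  then have "continuous_map X euclideanreal (f \<circ> fst)"
    unfolding X_def by (rule continuous_map_compose[OF continuous_map_fst])
  then have cont: "continuous_map (arrows \<G>) euclideanreal (\<lambda>a. f (fst a))"
    unfolding arrows comp_def by (rule continuous_map_from_subtopology)
  define S where "S = (\<Union>i\<in>I. {k. same_coset (\<phi> i) k \<and> (\<exists>y\<in>Y. split_action k y \<in> Y)}) \<inter> carrier G"
  have "finite S"
    unfolding S_def using assms by (intro finite_Int disjI1 finite_UN_I finite_coset_return) auto
  define K where "K = (\<Union>k\<in>S. {k} \<times> {y \<in> Y. split_action k y \<in> Y})"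
  have "compactin X K"
    unfolding K_def X_def
  proof (intro compactin_Union finite_imageI \<open>finite S\<close>)
    fix A assume "A \<in> (\<lambda>k. {k} \<times> {y \<in> Y. split_action k y \<in> Y}) ` S"
    then obtain k where "k \<in> carrier G" "A = {k} \<times> {y \<in> Y. split_action k y \<in> Y}"
      by (auto simp: S_def)
    then show "compactin (prod_topology (discrete_topology (carrier G)) (split_topology \<Gamma>)) A"
      using compact_return_set by (simp add: compactin_Times compactin_discrete_topology)
  qed
  then have "compactin (arrows \<G>) K"
    unfolding arrows compactin_subtopology by (auto simp: K_def S_def)
  moreover have "f (fst a) = 0" if "a \<in> topspace (arrows \<G>) - K" for a
  proof -
    have "{i \<in> I. same_coset (\<phi> i) (fst a)} = {}"
      using that by (auto simp: topspace_arrows K_def S_def)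
    then show ?thesis by (simp only: f_def card.empty)
  qed
  moreover have "f k \<ge> 0" for k by (simp add: f_def)
  ultimately show ?thesis
    using cont unfolding nonneg_Cc_def f_def by blast
qed

lemma amenable_groupoid: "amenable_groupoid \<G>"
proof -
  obtain I :: "nat \<Rightarrow> ((real \<Rightarrow> nat) \<times> (real \<Rightarrow> nat)) set" and \<phi>
    where I: "\<And>n. finite (I n)" "\<And>n. I n \<noteq> {}" "\<And>n. \<phi> n ` I n \<subseteq> carrier G"
    and inv: "\<And>g. g \<in> carrier G \<Longrightarrow>
      \<forall>\<^sub>F n in sequentially. almost_invariant (I n) (\<phi> n) (Suc n) g"
    by (rule ex_almost_invariant_sequence) (rule that)
  have \<phi>: "\<phi> n i \<in> carrier G" if "i \<in> I n" for n i using I(3) that by blast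
  define f where "f n = (\<lambda>a :: (real \<times> real) \<times> split_point.
    real (card {i \<in> I n. same_coset (\<phi> n i) (fst a)}) / real (card (I n)))" for n
  have f_fibre: "f n b = real (card {i \<in> I n. coset_arrow u (\<phi> n i) = b}) / real (card (I n))"
    if "u \<in> Y" "b \<in> range_fibre \<G> u" for n u b
  proof -
    have "{i \<in> I n. same_coset (\<phi> n i) (fst b)} = {i \<in> I n. coset_arrow u (\<phi> n i) = b}"
      using coset_arrow(2)[OF that(1) \<phi> that(2)] by blast
    then show ?thesis by (simp add: f_def)
  qed
  have "f n \<in> nonneg_Cc (arrows \<G>)" for n
    unfolding f_def by (rule coset_count_nonneg_Cc[OF I(1,3)])
  moreover have "uniform_limit K (\<lambda>f u. \<Sum>\<^sub>\<infinity>b\<in>range_fibre \<G> u. f b) (\<lambda>_. 1) (filtermap f sequentially)"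
    if K: "compactin (units \<G>) K" for K
  proof -
    have "(\<Sum>\<^sub>\<infinity>b\<in>range_fibre \<G> u. f n b) = 1" if "u \<in> K" for n u
    proof -
      have u: "u \<in> Y" using that compactin_subset_topspace[OF K] topspace_units by blast
      have "(\<Sum>\<^sub>\<infinity>b\<in>range_fibre \<G> u. f n b) =
        (\<Sum>\<^sub>\<infinity>b\<in>range_fibre \<G> u. real (card {i \<in> I n. coset_arrow u (\<phi> n i) = b}) / real (card (I n)))"
        by (intro infsum_cong f_fibre u)
      also have "\<dots> = 1"
        using coset_arrow(1)[OF u \<phi>] by (intro infsumI has_sum_card_fibres_normalised I) blast
      finally show ?thesis .
    qed
    then show ?thesis by (simp add: uniform_limit_iff eventually_filtermap)
  qed
  moreover have "uniform_limit K
      (\<lambda>f a. \<Sum>\<^sub>\<infinity>b\<in>range_fibre \<G> (grange \<G> a). \<bar>f (gcomp \<G> (ginv \<G> a) b) - f b\<bar>)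
      (\<lambda>_. 0) (filtermap f sequentially)"
    if K: "compactin (arrows \<G>) K" for K
    unfolding uniform_limit_iff eventually_filtermap
  proof (intro allI impI)
    fix e :: real assume "e > 0"
    have K_sub: "K \<subseteq> topspace (arrows \<G>)" using K by (rule compactin_subset_topspace)
    have "compactin (prod_topology (discrete_topology (carrier G)) (split_topology \<Gamma>)) K"
      using K unfolding split_groupoid_def restricted_transformation_groupoid_def
      by (simp add: compactin_subtopology)
    then have "compactin (discrete_topology (carrier G)) (fst ` K)"
      using continuous_map_fst by (rule image_compactin)
    then have fst_K: "finite (fst ` K)" "fst ` K \<subseteq> carrier G"
      by (simp_all add: compactin_discrete_topology)
    have eventually: "\<forall>\<^sub>F n in sequentially. 4 / real (Suc n) < e \<and>
        (\<forall>g\<in>fst ` K. almost_invariant (I n) (\<phi> n) (Suc n) g)"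
      by (rule eventually_almost_invariant[OF _ fst_K \<open>e > 0\<close>]) (rule inv)
    show "\<forall>\<^sub>F n in sequentially. \<forall>a\<in>K. dist
        (\<Sum>\<^sub>\<infinity>b\<in>range_fibre \<G> (grange \<G> a). \<bar>f n (gcomp \<G> (ginv \<G> a) b) - f n b\<bar>) 0 < e"
      using eventually
    proof eventually_elim
      case (elim n)
      show ?case
      proof
        fix a assume "a \<in> K"
        obtain g x where a: "a = (g, x)" by fastforce
        define u where "u = split_action g x"
        have g: "g \<in> carrier G" "almost_invariant (I n) (\<phi> n) (Suc n) g" and u: "u \<in> Y"
          using \<open>a \<in> K\<close> K_sub elim unfolding a u_def topspace_arrows by force+
        \<comment> \<open>Multiplication by \<open>g\<close> moves from the argument to the index:
          \<open>\<phi> n i\<close> shares a coset with \<open>inv g \<otimes> k\<close> exactly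
          when \<open>g \<otimes> \<phi> n i\<close> shares one with \<open>k\<close>. This gives
          the shape of \<open>almost_invariant_infsum_le\<close>.\<close>
        have "f n (gcomp \<G> (ginv \<G> a) b) =
            real (card {i \<in> I n. coset_arrow u (g \<otimes>\<^bsub>G\<^esub> \<phi> n i) = b}) / real (card (I n))"
          if b: "b \<in> range_fibre \<G> u" for b
        proof -
          obtain k y where ky: "b = (k, y)" by fastforce
          have k: "k \<in> carrier G" using b by (simp add: ky mem_range_fibre del: semidirect_simps)
          have "g \<otimes>\<^bsub>G\<^esub> (inv\<^bsub>G\<^esub> g \<otimes>\<^bsub>G\<^esub> k) = k"
            using g(1) k by (simp add: G.m_assoc[symmetric] del: semidirect_simps)
          then have "same_coset h (inv\<^bsub>G\<^esub> g \<otimes>\<^bsub>G\<^esub> k) \<longleftrightarrow> same_coset (g \<otimes>\<^bsub>G\<^esub> h) k" for h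
            using same_coset_mult_left[OF g(1), of h "inv\<^bsub>G\<^esub> g \<otimes>\<^bsub>G\<^esub> k"] by simp
          then have "same_coset (\<phi> n i) (inv\<^bsub>G\<^esub> g \<otimes>\<^bsub>G\<^esub> k) \<longleftrightarrow> coset_arrow u (g \<otimes>\<^bsub>G\<^esub> \<phi> n i) = b"
            if "i \<in> I n" for i
            using coset_arrow(2)[OF u G.m_closed[OF g(1) \<phi>[OF that]] b] ky by simp
          then have "{i \<in> I n. same_coset (\<phi> n i) (inv\<^bsub>G\<^esub> g \<otimes>\<^bsub>G\<^esub> k)} =
            {i \<in> I n. coset_arrow u (g \<otimes>\<^bsub>G\<^esub> \<phi> n i) = b}" by blast
          then show ?thesis by (simp add: f_def a ky del: semidirect_simps)
        qed
        then have "(\<Sum>\<^sub>\<infinity>b\<in>range_fibre \<G> u. \<bar>f n (gcomp \<G> (ginv \<G> a) b) - f n b\<bar>) =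
          (\<Sum>\<^sub>\<infinity>b\<in>range_fibre \<G> u.
            \<bar>real (card {i \<in> I n. coset_arrow u (g \<otimes>\<^bsub>G\<^esub> \<phi> n i) = b}) / real (card (I n)) -
             real (card {i \<in> I n. coset_arrow u (\<phi> n i) = b}) / real (card (I n))\<bar>)"
          by (intro infsum_cong) (simp only: f_fibre[OF u])
        also have "\<dots> \<le> 4 / real (Suc n)"
          using coset_arrow(1)[OF u]
          by (intro almost_invariant_infsum_le I g) auto
        also have "\<dots> < e" using elim by blast
        finally show "dist (\<Sum>\<^sub>\<infinity>b\<in>range_fibre \<G> (grange \<G> a).
            \<bar>f n (gcomp \<G> (ginv \<G> a) b) - f n b\<bar>) 0 < e"
          by (simp add: dist_real_def infsum_nonneg a u_def)
      qed
    qed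
  qed
  ultimately show ?thesis
    unfolding amenable_groupoid_def
    by (intro exI[of _ "filtermap f sequentially"]) (simp add: eventually_filtermap filtermap_bot_iff)
qed

end

theorem lemma4p5:
  fixes \<Lambda> \<Gamma> :: "real set" and l :: real
  assumes "subgroup \<Lambda> pos_real_mult_group"
    and "real_submodule \<Lambda> \<Gamma>"
    and "countable \<Gamma>"
    and "closure \<Gamma> = UNIV"
    and "l \<in> \<Gamma>" and "l > 0"
  shows "(topologically_free_action (semidirect \<Gamma> \<Lambda>) (split_topology \<Gamma>) split_action \<and>
          amenable_action (semidirect \<Gamma> \<Lambda>) (split_topology \<Gamma>) split_action \<and>
          minimal_action (semidirect \<Gamma> \<Lambda>) (split_topology \<Gamma>) split_action) \<and>
         (topologically_principal (split_groupoid \<Gamma> \<Lambda> l) \<and>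
          amenable_groupoid (split_groupoid \<Gamma> \<Lambda> l) \<and>
          minimal_groupoid (split_groupoid \<Gamma> \<Lambda> l))"
proof -
  interpret split_interval_groupoid \<Lambda> \<Gamma> l
    by (intro split_interval_groupoid.intro dense_scaling_submodule.intro scaling_submodule.intro
        dense_scaling_submodule_axioms.intro split_interval_groupoid_axioms.intro assms)
  show ?thesis
    using topologically_free amenable minimal topologically_principal amenable_groupoid
      minimal_groupoid by blast
qed

end
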